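(* Let $q$ be a prime power and $\mathbb{F}_q$ the field with $q$ elements. Let $\lambda \in \mathrm{CRS}_{\mathbb{F}_q}^e(\bigoplus_{\mathbb{N}} \mathbb{F}_q)$ with $\lambda\neq \delta_{\{0\}}$. Then there is a unique integer $\kappa\ge 0$ such that the random subgroup $\mathrm{Ker}(h)$ has law $\lambda$, where $h\in\mathrm{Hom}_{\mathbb{F}_q}(\bigoplus_{\mathbb{N}} \mathbb{F}_q,\mathbb{F}_q^\kappa)$ is a random homomorphism with law equal to the (normalized) Haar measure on the compact group $\mathrm{Hom}_{\mathbb{F}_q}(\bigoplus_{\mathbb{N}} \mathbb{F}_q,\mathbb{F}_q^\kappa)$.
   Context: $V=\bigoplus_{\mathbb{N}}\mathbb{F}_q$ is a countable discrete vector space. $\mathrm{Sub}_{\mathbb{F}_q}(V)$ is the compact space of linear subspaces of $V$, with the topology induced from the product topology on $\{0,1\}^V$. $\mathrm{Aut}_{\mathbb{F}_q}(V)$ is the group of all invertible linear maps $V\to V$, acting on $\mathrm{Sub}_{\mathbb{F}_q}(V)$. $\mathrm{CRS}_{\mathbb{F}_q}(V)$ is the convex set of $\mathrm{Aut}_{\mathbb{F}_q}(V)$-invariant Borel probability measures on $\mathrm{Sub}_{\mathbb{F}_q}(V)$, and $\mathrm{CRS}^e_{\mathbb{F}_q}(V)$ is its set of extreme points. $\delta_W$ is the Dirac measure at the subspace $W$. $\mathrm{Hom}_{\mathbb{F}_q}$ denotes linear maps, a group under pointwise addition with the topology of pointwise convergence. *)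

theory Defs
  imports "HOL-Probability.Probability" "HOL-Library.Poly_Mapping"
begin

section \<open>The vector space \<open>V = \<Oplus>\<^sub>\<nat> \<F>\<^sub>q\<close>\<close>

text \<open>
  The field \<open>\<F>\<^sub>q\<close> is a type \<open>'k\<close> of class \<open>{finite, field}\<close>; then \<open>q = CARD('k)\<close> is a prime power.
\<close>

type_synonym 'k V = "nat \<Rightarrow>\<^sub>0 'k"

definition scale :: "'k::field \<Rightarrow> 'k V \<Rightarrow> 'k V" where
  "scale c v = Poly_Mapping.map ((*) c) v"

lemma lookup_scale [simp]: "Poly_Mapping.lookup (scale c v) n = c * Poly_Mapping.lookup v n"
  by (simp add: scale_def Poly_Mapping.map.rep_eq when_def)

global_interpretation V: vector_space scale
  by unfold_locales (rule poly_mapping_eqI, simp add: lookup_add algebra_simps)+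

definition Aut :: "('k::field V \<Rightarrow> 'k V) set" where
  "Aut = {f. Vector_Spaces.linear scale scale f \<and> bij f}"

text \<open>\<open>\<F>\<^sub>q\<^sup>\<kappa>\<close>, realised as the span of the first \<open>\<kappa>\<close> standard basis vectors of \<open>V\<close>.\<close>

definition coord_space :: "nat \<Rightarrow> 'k::field V set" where
  "coord_space \<kappa> = {x. Poly_Mapping.keys x \<subseteq> {..<\<kappa>}}"


section \<open>Characteristic random subspaces\<close>

definition borel_of :: "'a topology \<Rightarrow> 'a measure" where
  "borel_of X = sigma (topspace X) {U. openin X U}"

definition Sub :: "'k::field V set set" where
  "Sub = {W. V.subspace W}"

definition Sub_topology :: "'k::field V set topology" where
  "Sub_topology =
     pullback_topology Sub (\<lambda>W v. v \<in> W) (product_topology (\<lambda>_. discrete_topology (UNIV :: bool set)) UNIV)"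

definition CRS :: "'k::field V set measure set" where
  "CRS = {\<mu>. prob_space \<mu> \<and> sets \<mu> = sets (borel_of Sub_topology) \<and>
             (\<forall>f\<in>Aut. distr \<mu> (borel_of Sub_topology) (\<lambda>W. f ` W) = \<mu>)}"

text \<open>
  Measures do not form a real vector space type, so \<open>extreme_point_of\<close> does not apply; the
  following is the same notion, with convex combinations of measures taken setwise.
\<close>

definition CRS_extreme :: "'k::field V set measure set" where
  "CRS_extreme = {\<mu>\<in>CRS. \<not> (\<exists>\<mu>\<^sub>1\<in>CRS. \<exists>\<mu>\<^sub>2\<in>CRS. \<exists>t::real. \<mu>\<^sub>1 \<noteq> \<mu>\<^sub>2 \<and> 0 < t \<and> t < 1 \<and>
      (\<forall>A\<in>sets (borel_of Sub_topology). measure \<mu> A = (1 - t) * measure \<mu>\<^sub>1 A + t * measure \<mu>\<^sub>2 A))}"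


section \<open>Haar measure on the group of homomorphisms\<close>

definition Hom :: "nat \<Rightarrow> ('k::field V \<Rightarrow> 'k V) set" where
  "Hom \<kappa> = {h. Vector_Spaces.linear scale scale h \<and> range h \<subseteq> coord_space \<kappa>}"

definition Hom_topology :: "nat \<Rightarrow> ('k::field V \<Rightarrow> 'k V) topology" where
  "Hom_topology \<kappa> =
     subtopology (product_topology (\<lambda>_. discrete_topology (coord_space \<kappa>)) UNIV) (Hom \<kappa>)"

text \<open>
  The normalized Haar measure of a compact group with topology \<open>X\<close> and group operation \<open>m\<close>. The
  groups \<open>Hom \<kappa>\<close> are abelian, compact and metrizable, so left and right invariance agree and
  regularity of Borel probability measures is automatic.
\<close>

definition is_normalized_haar :: "'g topology \<Rightarrow> ('g \<Rightarrow> 'g \<Rightarrow> 'g) \<Rightarrow> 'g measure \<Rightarrow> bool" where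
  "is_normalized_haar X m \<mu> \<longleftrightarrow>
     prob_space \<mu> \<and> sets \<mu> = sets (borel_of X) \<and>
     (\<forall>g\<in>topspace X. distr \<mu> (borel_of X) (m g) = \<mu>)"

definition is_haar_Hom :: "nat \<Rightarrow> ('k::field V \<Rightarrow> 'k V) measure \<Rightarrow> bool" where
  "is_haar_Hom \<kappa> \<mu> \<longleftrightarrow> is_normalized_haar (Hom_topology \<kappa>) (\<lambda>g h v. g v + h v) \<mu>"

definition Ker :: "('k::field V \<Rightarrow> 'k V) \<Rightarrow> 'k V set" where
  "Ker h = {v. h v = 0}"

lemma topspace_Sub_topology [simp]: "topspace Sub_topology = Sub"
  by (simp add: Sub_topology_def topspace_pullback_topology)

lemma topspace_Hom_topology [simp]: "topspace (Hom_topology \<kappa>) = Hom \<kappa>"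
  by (auto simp: Hom_topology_def Hom_def)

lemma zero_in_coord_space [simp]: "0 \<in> coord_space \<kappa>"
  by (simp add: coord_space_def)

lemma space_borel_of [simp]: "space (borel_of X) = topspace X"
  unfolding borel_of_def by (rule space_measure_of) (auto dest: openin_subset)

lemma sets_borel_of: "sets (borel_of X) = sigma_sets (topspace X) {U. openin X U}"
  unfolding borel_of_def by (rule sets_measure_of) (auto dest: openin_subset)

lemma continuous_map_measurable_borel_of:
  assumes "continuous_map X Y f"
  shows "f \<in> measurable (borel_of X) (borel_of Y)"
proof -
  have "f \<in> measurable (borel_of X) (sigma (topspace Y) {U. openin Y U})"
  proof (rule measurable_measure_of)
    show "{U. openin Y U} \<subseteq> Pow (topspace Y)" by (auto dest: openin_subset)
    show "f \<in> space (borel_of X) \<rightarrow> topspace Y"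
      using assms by (auto simp: continuous_map_def)
    fix U assume "U \<in> {U. openin Y U}"
    then have "openin X {x \<in> topspace X. f x \<in> U}"
      using assms by (auto simp: continuous_map_def)
    moreover have "f -` U \<inter> space (borel_of X) = {x \<in> topspace X. f x \<in> U}" by auto
    ultimately show "f -` U \<inter> space (borel_of X) \<in> sets (borel_of X)"
      by (auto simp: sets_borel_of intro: sigma_sets.Basic)
  qed
  then show ?thesis by (simp add: borel_of_def)
qed

lemma subspace_Ker:
  assumes "Vector_Spaces.linear scale scale h"
  shows "V.subspace (Ker h)"
proof -
  interpret h: Vector_Spaces.linear scale scale h by fact
  show ?thesis
    by (auto simp: V.subspace_def Ker_def h.add h.scale h.zero)
qed

lemma continuous_map_Ker:
  "continuous_map (Hom_topology \<kappa>) Sub_topology (Ker :: ('k::field V \<Rightarrow> 'k V) \<Rightarrow> 'k V set)"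
  unfolding Sub_topology_def
proof (rule continuous_map_pullback')
  show "topspace (Hom_topology \<kappa>) \<subseteq> Ker -` Sub"
    by (auto simp: Sub_def Hom_def intro: subspace_Ker)
  have eval: "continuous_map (Hom_topology \<kappa>) (discrete_topology UNIV) (\<lambda>h :: 'k V \<Rightarrow> 'k V. h v = 0)" for v
  proof -
    have "continuous_map (Hom_topology \<kappa>) (discrete_topology (coord_space \<kappa>)) (\<lambda>h. h v)"
      unfolding Hom_topology_def
      by (intro continuous_map_from_subtopology continuous_map_product_projection) simp
    moreover have "continuous_map (discrete_topology (coord_space \<kappa>)) (discrete_topology UNIV) (\<lambda>x::'k V. x = 0)"
      by simp
    ultimately show ?thesis
      by (rule continuous_map_compose[unfolded comp_def])
  qed
  show "continuous_map (Hom_topology \<kappa>)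
      (product_topology (\<lambda>_. discrete_topology (UNIV :: bool set)) UNIV) ((\<lambda>W v. v \<in> W) \<circ> (Ker :: ('k V \<Rightarrow> 'k V) \<Rightarrow> 'k V set))"
    unfolding continuous_map_componentwise_UNIV using eval by (simp add: Ker_def)
qed

lemma measurable_Ker: "Ker \<in> measurable (borel_of (Hom_topology \<kappa>)) (borel_of Sub_topology)"
  by (rule continuous_map_measurable_borel_of) (rule continuous_map_Ker)

end

theory Submission
  imports Defs
begin

text \<open>
  Let \<open>V\<^sub>n\<close> be the span of the first \<open>n\<close> basis vectors. The density
  \<open>\<bar>W \<inter> V\<^sub>n\<bar> / \<bar>V\<^sub>n\<bar>\<close> of a subspace \<open>W\<close> converges to the reciprocal of its index, which is \<open>0\<close> or
  some \<open>q\<^bsup>-\<kappa>\<^esup>\<close>. The index is invariant under automorphisms, so for an extreme law the limit is almost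
  surely a constant \<open>x\<close>. For independent \<open>B\<close> the probability of \<open>B \<union> {u} \<subseteq> W\<close> is the same for
  all \<open>u\<close> outside the span of \<open>B\<close>; averaging over \<open>u \<in> V\<^sub>n\<close> and letting \<open>n\<close> grow shows that it is \<open>x\<close>
  times the probability of \<open>B \<subseteq> W\<close>. Hence \<open>B \<subseteq> W\<close> has probability \<open>x\<^bsup>\<bar>B\<bar>\<^esup>\<close>, and these
  numbers determine the law. The case \<open>x = 0\<close> is the Dirac measure at \<open>{0}\<close>, and \<open>x = q\<^bsup>-\<kappa>\<^esup>\<close> is the
  law of the kernel of a Haar random homomorphism into \<open>\<F>\<^sub>q\<^sup>\<kappa>\<close>.
\<close>

subsection \<open>Coordinate subspaces\<close>

lemma subspace_coord_space: "V.subspace (coord_space n :: 'k::field V set)"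
  unfolding V.subspace_def coord_space_def
proof safe
  fix x y :: "'k V" and i
  assume "Poly_Mapping.keys x \<subseteq> {..<n}" "Poly_Mapping.keys y \<subseteq> {..<n}" "i \<in> Poly_Mapping.keys (x + y)"
  then show "i < n" using keys_add[of x y] by blast
next
  fix c and x :: "'k V" and i
  assume "Poly_Mapping.keys x \<subseteq> {..<n}" "i \<in> Poly_Mapping.keys (scale c x)"
  then have "i \<in> Poly_Mapping.keys x" by (simp add: in_keys_iff)
  then show "i < n" using \<open>Poly_Mapping.keys x \<subseteq> {..<n}\<close> by blast
qed simp

text \<open>Reading off the first \<open>n\<close> coordinates is a bijection onto the functions
  from \<open>{..<n}\<close> to the field, since all later coordinates vanish.\<close>

lemma card_coord_space:
  "finite (coord_space n :: 'k::{finite,field} V set)"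
  "card (coord_space n :: 'k::{finite,field} V set) = CARD('k) ^ n"
proof -
  define F where "F = (PiE {..<n} (\<lambda>_. UNIV) :: (nat \<Rightarrow> 'k) set)"
  have "bij_betw (\<lambda>x. restrict (Poly_Mapping.lookup x) {..<n}) (coord_space n :: 'k V set) F"
    unfolding bij_betw_def
  proof
    show "inj_on (\<lambda>x. restrict (Poly_Mapping.lookup x) {..<n}) (coord_space n :: 'k V set)"
    proof (rule inj_onI, rule poly_mapping_eqI)
      fix x y :: "'k V" and i
      assume xy: "x \<in> coord_space n" "y \<in> coord_space n"
        and eq: "restrict (Poly_Mapping.lookup x) {..<n} = restrict (Poly_Mapping.lookup y) {..<n}"
      show "Poly_Mapping.lookup x i = Poly_Mapping.lookup y i"
      proof (cases "i < n")
        case True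
        then show ?thesis using fun_cong[OF eq, of i] by simp
      next
        case False
        then have "i \<notin> Poly_Mapping.keys x" "i \<notin> Poly_Mapping.keys y"
          using xy by (auto simp: coord_space_def)
        then show ?thesis by (simp add: in_keys_iff)
      qed
    qed
    show "(\<lambda>x. restrict (Poly_Mapping.lookup x) {..<n}) ` (coord_space n :: 'k V set) = F"
    proof safe
      fix f assume f: "f \<in> F"
      have fin: "finite {i. (if i < n then f i else 0) \<noteq> 0}"
        by (rule finite_subset[of _ "{..<n}"]) (auto split: if_splits)
      define x where "x = Abs_poly_mapping (\<lambda>i. if i < n then f i else 0)"
      have lx: "Poly_Mapping.lookup x = (\<lambda>i. if i < n then f i else 0)"
        unfolding x_def using fin by (rule lookup_Abs_poly_mapping)
      have "x \<in> coord_space n"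
        by (auto simp: coord_space_def in_keys_iff lx split: if_splits)
      moreover have "f = restrict (Poly_Mapping.lookup x) {..<n}"
        using f by (auto simp: lx F_def PiE_def extensional_def)
      ultimately show "f \<in> (\<lambda>x. restrict (Poly_Mapping.lookup x) {..<n}) ` coord_space n"
        by blast
    qed (auto simp: F_def)
  qed
  moreover have "finite F" "card F = CARD('k) ^ n"
    by (auto simp: F_def finite_PiE card_PiE)
  ultimately show "finite (coord_space n :: 'k V set)"
    "card (coord_space n :: 'k V set) = CARD('k) ^ n"
    by (auto dest: bij_betw_finite bij_betw_same_card)
qed

lemma coord_space_mono: "m \<le> n \<Longrightarrow> coord_space m \<subseteq> coord_space n"
  by (auto simp: coord_space_def)

lemma ex_coord_space: "\<exists>n. x \<in> coord_space n"
proof -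
  obtain n where "Poly_Mapping.keys x \<subseteq> {..<n}"
    using finite_nat_iff_bounded[of "Poly_Mapping.keys x"] by auto
  then show ?thesis by (auto simp: coord_space_def)
qed

lemma finite_subset_coord_space:
  assumes "finite F"
  shows "\<exists>n. F \<subseteq> coord_space n"
  using assms
proof induction
  case (insert x F)
  then obtain n where "F \<subseteq> coord_space n" by blast
  moreover obtain m where "x \<in> coord_space m" using ex_coord_space by blast
  ultimately have "insert x F \<subseteq> coord_space (max m n)"
    using coord_space_mono[of m "max m n"] coord_space_mono[of n "max m n"] by auto
  then show ?case by blast
qed simp

lemma countable_UNIV_V: "countable (UNIV :: 'k::{finite,field} V set)"
proof -
  have "(UNIV :: 'k V set) = (\<Union>n. coord_space n)"
    using ex_coord_space by auto
  moreover have "countable (\<Union>n. coord_space n :: 'k V set)"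
    by (intro countable_UN countable_finite card_coord_space countableI_type)
  ultimately show ?thesis by simp
qed

text \<open>Coordinates with respect to a basis identify \<open>U\<close> with the functions from
  that basis to the field. Later this forces a finite index to be a power of
  \<open>q\<close>.\<close>

lemma card_finite_subspace:
  assumes "V.subspace U" "finite (U :: 'k::{finite,field} V set)"
  shows "\<exists>d. card U = CARD('k) ^ d"
proof -
  obtain B where B: "B \<subseteq> U" "V.independent B" "U \<subseteq> V.span B"
    using V.maximal_independent_subset[of U] by blast
  have finB: "finite B" using B(1) assms(2) finite_subset by blast
  have U: "U = V.span B" using B assms(1) by (metis V.span_subspace)
  define \<phi> where "\<phi> = (\<lambda>c. \<Sum>b\<in>B. scale (c b) b)"
  have "bij_betw \<phi> (PiE B (\<lambda>_. UNIV)) U"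
    unfolding bij_betw_def
  proof
    show "inj_on \<phi> (PiE B (\<lambda>_. UNIV))"
    proof (rule inj_onI, rule ext)
      fix c d b assume cd: "c \<in> PiE B (\<lambda>_. UNIV)" "d \<in> PiE B (\<lambda>_. UNIV)" "\<phi> c = \<phi> d"
      have "(\<Sum>b\<in>B. scale (c b - d b) b) = 0"
        using cd(3) by (simp add: \<phi>_def V.scale_left_diff_distrib sum_subtractf)
      then have "c b - d b = 0" if "b \<in> B"
        using V.independentD[OF B(2) finB order_refl _ that, of "\<lambda>b. c b - d b"] by blast
      then show "c b = d b" using cd PiE_arb[OF cd(1)] PiE_arb[OF cd(2)] by (cases "b \<in> B") auto
    qed
    show "\<phi> ` PiE B (\<lambda>_. UNIV) = U"
    proof safe
      fix x assume "x \<in> U"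
      then obtain u where u: "x = (\<Sum>b\<in>B. scale (u b) b)"
        unfolding U V.span_finite[OF finB] by blast
      then have "x = \<phi> (restrict u B)" by (simp add: \<phi>_def)
      then show "x \<in> \<phi> ` PiE B (\<lambda>_. UNIV)" by (rule image_eqI[where f = \<phi>]) simp
    next
      fix c
      show "\<phi> c \<in> U"
        unfolding \<phi>_def U by (intro V.span_sum V.span_scale V.span_base)
    qed
  qed
  from bij_betw_same_card[OF this] have "card U = CARD('k) ^ card B"
    by (simp add: card_PiE finB)
  then show ?thesis ..
qed

section \<open>Automorphisms that fix an independent set and move one further vector\<close>

interpretation VV: vector_space_pair scale scale
  by unfold_locales

text \<open>Let \<open>l x\<close> be coordinate \<open>0\<close> of \<open>g x\<close>, a linear
  functional. The map sends \<open>v\<close> to \<open>v'\<close> and fixes the kernel of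
  \<open>l\<close>. It multiplies \<open>l\<close> by \<open>l v'\<close>, because
  \<open>l v = 1\<close>, so subtracting \<open>l x / l v'\<close> times \<open>v' - v\<close>
  inverts it.\<close>

lemma transvection_in_Aut:
  assumes "Vector_Spaces.linear scale scale g"
    and one: "Poly_Mapping.lookup (g (v::'k::field V)) 0 = 1" and "Poly_Mapping.lookup (g v') 0 \<noteq> 0"
  shows "(\<lambda>x. x + scale (Poly_Mapping.lookup (g x) 0) (v' - v)) \<in> Aut"
proof -
  interpret g: Vector_Spaces.linear scale scale g by fact
  let ?a = "Poly_Mapping.lookup (g v') 0"
  let ?f = "\<lambda>x. x + scale (Poly_Mapping.lookup (g x) 0) (v' - v)"
  let ?h = "\<lambda>x. x - scale (Poly_Mapping.lookup (g x) 0 / ?a) (v' - v)"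
  have "Vector_Spaces.linear scale scale ?f"
    unfolding Vector_Spaces.linear_iff using V.vector_space_axioms
    by (auto simp: g.add g.scale lookup_add V.scale_left_distrib V.scale_right_distrib)
  moreover have "?h (?f x) = x" for x
  proof -
    have "Poly_Mapping.lookup (g (?f x)) 0 = Poly_Mapping.lookup (g x) 0 * ?a"
      by (simp add: g.add g.scale g.diff lookup_add lookup_minus one algebra_simps)
    then show ?thesis using assms(3) by simp
  qed
  moreover have "?f (?h x) = x" for x
  proof -
    have "Poly_Mapping.lookup (g (?h x)) 0 = Poly_Mapping.lookup (g x) 0 / ?a"
      using assms(3) by (simp add: g.scale g.diff lookup_minus one right_diff_distrib)
    then show ?thesis by simp
  qed
  ultimately show ?thesis
    unfolding Aut_def using o_bij[of ?h ?f] by (auto simp: fun_eq_iff)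
qed

text \<open>It suffices to find a functional that vanishes on \<open>B\<close>, equals
  \<open>1\<close> at \<open>v\<close> and is nonzero at \<open>v'\<close>; the associated map
  \<open>x + l(x) (v' - v)\<close> then does what is required.\<close>

lemma ex_Aut_fixing:
  assumes B: "V.independent B" and v: "v \<notin> V.span B" and v': "v' \<notin> V.span (B :: 'k::field V set)"
  shows "\<exists>f\<in>Aut. f v = v' \<and> (\<forall>b\<in>B. f b = b)"
proof -
  let ?e = "Poly_Mapping.single 0 (1::'k)"
  have indv: "V.independent (insert v B)" using B v by (simp add: V.independent_insert)
  have vB: "v \<notin> B" "v' \<notin> B" using v v' V.span_base by blast+
  \<comment> \<open>The functional is coordinate \<open>0\<close> of an endomorphism
    \<open>g\<close>. If \<open>v'\<close> lies in the span of \<open>insert v B\<close>, its value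
    there is forced to be the coefficient \<open>k\<close> of \<open>v\<close>, which is nonzero
    because \<open>v'\<close> is outside the span of \<open>B\<close>. Otherwise \<open>v'\<close>
    is independent of the rest and the value can be prescribed.\<close>
  have "\<exists>g. Vector_Spaces.linear scale scale g \<and> (\<forall>b\<in>B. g b = 0) \<and> g v = ?e \<and>
     Poly_Mapping.lookup (g v') 0 \<noteq> 0"
  proof (cases "v' \<in> V.span (insert v B)")
    case True
    obtain g where g: "Vector_Spaces.linear scale scale g" "\<forall>x\<in>insert v B. g x = (if x = v then ?e else 0)"
      using VV.linear_independent_extend[OF indv, of "\<lambda>x. if x = v then ?e else 0"] by blast
    interpret g: Vector_Spaces.linear scale scale g by fact
    have gB: "g b = 0" if "b \<in> B" for b using g(2) that vB by auto
    obtain k where k: "v' - scale k v \<in> V.span B"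
      using True V.in_span_insert V.span_breakdown_eq by blast
    have "g x = 0" if "x \<in> V.span B" for x
      using that
      by (rule V.span_induct) (auto simp: V.subspace_def g.add g.scale gB g.zero)
    from this[OF k] have "g v' = scale k ?e" using g(2) by (simp add: g.diff g.scale)
    moreover have "k \<noteq> 0" using k v' by auto
    ultimately show ?thesis using g gB by auto
  next
    case False
    then have ind: "V.independent (insert v' (insert v B))" using indv by (simp add: V.independent_insert)
    obtain g where g: "Vector_Spaces.linear scale scale g" "\<forall>x\<in>insert v' (insert v B). g x = (if x \<in> B then 0 else ?e)"
      using VV.linear_independent_extend[OF ind, of "\<lambda>x. if x \<in> B then 0 else ?e"] by blast
    then show ?thesis using vB by auto
  qed
  then obtain g where g: "Vector_Spaces.linear scale scale g" "\<forall>b\<in>B. g b = 0" "g v = ?e"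
     "Poly_Mapping.lookup (g v') 0 \<noteq> 0" by blast
  have "(\<lambda>x. x + scale (Poly_Mapping.lookup (g x) 0) (v' - v)) \<in> Aut"
    using g by (intro transvection_in_Aut) auto
  then show ?thesis
    by (rule bexI[rotated]) (simp add: g)
qed

subsection \<open>Generators of the Borel algebras\<close>

text \<open>With countably many coordinates and countably many values there are only countably many
  cylinders, so an open set is a countable union of them. Measurability thus reduces to single
  coordinates.\<close>

lemma measurable_openin_product_discrete:
  fixes \<phi> :: "'s \<Rightarrow> 'i \<Rightarrow> 'a"
  assumes U: "openin (product_topology (\<lambda>_. discrete_topology D) UNIV) U"
    and cI: "countable (UNIV :: 'i set)" and cD: "countable D"
    and \<phi>: "\<And>s i. s \<in> space M \<Longrightarrow> \<phi> s i \<in> D"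
    and meas: "\<And>i x. x \<in> D \<Longrightarrow> {s \<in> space M. \<phi> s i = x} \<in> sets M"
  shows "{s \<in> space M. \<phi> s \<in> U} \<in> sets M"
proof -
  define K where "K = {(I, p). finite I \<and> p \<in> PiE I (\<lambda>_. D) \<and> {f. range f \<subseteq> D \<and> (\<forall>i\<in>I. f i = p i)} \<subseteq> U}"
  have cK: "countable K"
  proof (rule countable_subset)
    show "K \<subseteq> (SIGMA I:{I. finite I \<and> I \<subseteq> UNIV}. PiE I (\<lambda>_. D))" by (auto simp: K_def)
    show "countable (SIGMA I:{I::'i set. finite I \<and> I \<subseteq> UNIV}. PiE I (\<lambda>_. D))"
      using cI cD by (intro countable_SIGMA countable_Collect_finite_subset countable_PiE) auto
  qed
  have "{s \<in> space M. \<phi> s \<in> U} = (\<Union>(I, p)\<in>K. {s \<in> space M. \<forall>i\<in>I. \<phi> s i = p i})"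
  proof safe
    fix s assume s: "s \<in> space M" "\<phi> s \<in> U"
    obtain X where X: "finite {i \<in> UNIV. X i \<noteq> topspace (discrete_topology D)}"
       "\<phi> s \<in> Pi\<^sub>E UNIV X" "Pi\<^sub>E UNIV X \<subseteq> U"
      using U s(2) unfolding openin_product_topology_alt by meson
    \<comment> \<open>These are the finitely many coordinates that the basic neighbourhood
      restricts; pinning the values of \<open>\<phi> s\<close> there gives a cylinder inside
      \<open>U\<close>.\<close>
    let ?I = "{i. X i \<noteq> D}"
    have "(?I, restrict (\<phi> s) ?I) \<in> K"
      unfolding K_def
    proof (intro CollectI case_prodI conjI subsetI)
      show "finite ?I" using X(1) by simp
      show "restrict (\<phi> s) ?I \<in> PiE ?I (\<lambda>_. D)" using \<phi>[OF s(1)] by auto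
      fix f assume "f \<in> {f. range f \<subseteq> D \<and> (\<forall>i\<in>?I. f i = restrict (\<phi> s) ?I i)}"
      then have f: "range f \<subseteq> D" "\<forall>i\<in>?I. f i = restrict (\<phi> s) ?I i" by auto
      have "f i \<in> X i" for i
        using f X(2) by (cases "X i = D") (auto simp: PiE_iff)
      then show "f \<in> U" using X(3) by (auto simp: PiE_iff)
    qed
    then show "s \<in> (\<Union>(I, p)\<in>K. {s \<in> space M. \<forall>i\<in>I. \<phi> s i = p i})"
      using s(1) by (intro UN_I[of "(?I, restrict (\<phi> s) ?I)"]) simp_all
  qed (use \<phi> in \<open>auto simp: K_def\<close>)
  also have "\<dots> \<in> sets M"
  proof (rule sets.countable_UN''[OF cK], clarify)
    fix I p assume "(I, p) \<in> K"
    then show "{s \<in> space M. \<forall>i\<in>I. \<phi> s i = p i} \<in> sets M"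
      using meas by (intro sets.sets_Collect_finite_All) (auto simp: K_def)
  qed
  finally show ?thesis .
qed

lemma measurable_borel_ofI:
  assumes "f \<in> space M \<rightarrow> topspace X" "\<And>U. openin X U \<Longrightarrow> {s \<in> space M. f s \<in> U} \<in> sets M"
  shows "f \<in> measurable M (borel_of X)"
  unfolding borel_of_def
proof (rule measurable_measure_of)
  show "{U. openin X U} \<subseteq> Pow (topspace X)" by (auto dest: openin_subset)
  show "f \<in> space M \<rightarrow> topspace X" by fact
  fix U assume "U \<in> {U. openin X U}"
  then have "{s \<in> space M. f s \<in> U} \<in> sets M" using assms(2) by blast
  also have "{s \<in> space M. f s \<in> U} = f -` U \<inter> space M" by auto
  finally show "f -` U \<inter> space M \<in> sets M" .
qed

lemma measurable_borel_of_Sub: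
  fixes f :: "'s \<Rightarrow> 'k::{finite,field} V set"
  assumes f: "\<And>s. s \<in> space M \<Longrightarrow> f s \<in> Sub" and "\<And>v. {s \<in> space M. v \<in> f s} \<in> sets M"
  shows "f \<in> measurable M (borel_of Sub_topology)"
proof (rule measurable_borel_ofI)
  show "f \<in> space M \<rightarrow> topspace Sub_topology" using f by auto
  fix U :: "'k V set set" assume "openin Sub_topology U"
  then obtain T where T: "openin (product_topology (\<lambda>_. discrete_topology (UNIV :: bool set)) UNIV) T"
    "U = (\<lambda>W v. v \<in> W) -` T \<inter> Sub"
    unfolding Sub_topology_def openin_pullback_topology by blast
  have "{s \<in> space M. (\<lambda>v. v \<in> f s) \<in> T} \<in> sets M"
  proof (rule measurable_openin_product_discrete[OF T(1)])
    fix i x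
    show "{s \<in> space M. (i \<in> f s) = x} \<in> sets M"
      using assms(2)[of i] sets.sets_Collect_neg[OF assms(2)[of i]] by (cases x) auto
  qed (auto simp: countable_UNIV_V)
  also have "{s \<in> space M. (\<lambda>v. v \<in> f s) \<in> T} = {s \<in> space M. f s \<in> U}"
    using f by (auto simp: T)
  finally show "{s \<in> space M. f s \<in> U} \<in> sets M" .
qed

lemma measurable_borel_of_Hom:
  fixes f :: "'s \<Rightarrow> 'k::{finite,field} V \<Rightarrow> 'k V"
  assumes f: "\<And>s. s \<in> space M \<Longrightarrow> f s \<in> Hom \<kappa>"
    and "\<And>v x. x \<in> coord_space \<kappa> \<Longrightarrow> {s \<in> space M. f s v = x} \<in> sets M"
  shows "f \<in> measurable M (borel_of (Hom_topology \<kappa>))"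
proof (rule measurable_borel_ofI)
  show "f \<in> space M \<rightarrow> topspace (Hom_topology \<kappa>)" using f by auto
  fix U :: "('k V \<Rightarrow> 'k V) set" assume "openin (Hom_topology \<kappa>) U"
  then obtain T where T: "openin (product_topology (\<lambda>_. discrete_topology (coord_space \<kappa> :: 'k V set)) UNIV) T"
    "U = T \<inter> Hom \<kappa>"
    unfolding Hom_topology_def openin_subtopology by blast
  have "{s \<in> space M. f s \<in> T} \<in> sets M"
    using assms f by (intro measurable_openin_product_discrete[OF T(1)])
      (auto simp: countable_UNIV_V countable_finite card_coord_space Hom_def)
  also have "{s \<in> space M. f s \<in> T} = {s \<in> space M. f s \<in> U}"
    using f by (auto simp: T)
  finally show "{s \<in> space M. f s \<in> U} \<in> sets M" .
qed

lemma sets_contains: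
  fixes v :: "'k::{finite,field} V"
  shows "{W\<in>Sub. v \<in> W} \<in> sets (borel_of Sub_topology)"
proof -
  have "openin (product_topology (\<lambda>_. discrete_topology UNIV) UNIV) {f :: 'k V \<Rightarrow> bool. f v \<in> {True}}"
    using openin_continuous_map_preimage[OF continuous_map_product_projection[of v UNIV "\<lambda>_. discrete_topology UNIV"], of "{True}"]
    by simp
  then have "openin Sub_topology {W\<in>Sub. v \<in> W}"
    unfolding Sub_topology_def openin_pullback_topology
    by (intro exI[of _ "{f. f v \<in> {True}}"]) auto
  then show ?thesis by (auto simp: sets_borel_of intro: sigma_sets.Basic)
qed

text \<open>As \<open>V\<close> is countable, this is a countable intersection even for infinite
  \<open>F\<close>. The empty \<open>F\<close> is treated apart, because an empty intersection is
  not contained in \<open>Sub\<close>.\<close>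

lemma sets_contains_subset:
  fixes F :: "'k::{finite,field} V set"
  shows "{W\<in>Sub. F \<subseteq> W} \<in> sets (borel_of Sub_topology)"
proof -
  have "countable F" by (rule countable_subset[OF subset_UNIV countable_UNIV_V])
  then have "(\<lambda>v. {W\<in>Sub. v \<in> W}) ` F \<subseteq> sets (borel_of Sub_topology) \<Longrightarrow> F \<noteq> {} \<Longrightarrow>
      (\<Inter>v\<in>F. {W\<in>Sub. v \<in> W}) \<in> sets (borel_of Sub_topology)"
    by (intro sets.countable_INT') auto
  moreover have "(\<Inter>v\<in>F. {W\<in>Sub. v \<in> W}) = {W\<in>Sub. F \<subseteq> W}" if "F \<noteq> {}"
    using that by auto
  moreover have "{W\<in>Sub. {} \<subseteq> W} \<in> sets (borel_of Sub_topology)"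
    using sets.top[of "borel_of Sub_topology"] by simp
  ultimately show ?thesis using sets_contains by (cases "F = {}") auto
qed

lemma sets_eval_Hom:
  fixes v :: "'k::{finite,field} V"
  shows "{h\<in>Hom \<kappa>. h v = x} \<in> sets (borel_of (Hom_topology \<kappa>))"
proof (cases "x \<in> coord_space \<kappa>")
  case True
  let ?T = "product_topology (\<lambda>_::'k V. discrete_topology (coord_space \<kappa> :: 'k V set)) UNIV"
  have "openin ?T {f \<in> topspace ?T. f v \<in> {x}}"
    using True by (intro openin_continuous_map_preimage[OF continuous_map_product_projection]) auto
  then have "openin (Hom_topology \<kappa>) {h\<in>Hom \<kappa>. h v = x}"
    unfolding Hom_topology_def openin_subtopology
    by (intro exI[of _ "{f \<in> topspace ?T. f v \<in> {x}}"]) (auto simp: Hom_def)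
  then show ?thesis by (auto simp: sets_borel_of intro: sigma_sets.Basic)
next
  case False
  then have "{h\<in>Hom \<kappa>. h v = x} = {}" by (auto simp: Hom_def)
  then show ?thesis by (metis sets.empty_sets)
qed

text \<open>The generators are Borel. Conversely the identity is measurable from the algebra they
  generate to the Borel algebra, because each coordinate event \<open>v \<in> W\<close> is the
  generator for \<open>F = {v}\<close>.\<close>

lemma borel_of_Sub_generator:
  "sets (borel_of Sub_topology) =
     sigma_sets Sub ((\<lambda>F. {W\<in>Sub. F \<subseteq> W}) ` {F :: 'k::{finite,field} V set. finite F})"
proof
  let ?G = "(\<lambda>F. {W\<in>Sub. F \<subseteq> W}) ` {F :: 'k V set. finite F}"
  let ?M = "sigma Sub ?G"
  have G: "?G \<subseteq> Pow Sub" by auto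
  have "(\<lambda>W. W) \<in> measurable ?M (borel_of Sub_topology)"
  proof (rule measurable_borel_of_Sub)
    fix v :: "'k V"
    have "{W\<in>Sub. {v} \<subseteq> W} \<in> sigma_sets Sub ?G" by (intro sigma_sets.Basic imageI) simp
    then show "{W \<in> space ?M. v \<in> W} \<in> sets ?M" using G by simp
  qed (use G in simp)
  note id = this
  show "sets (borel_of Sub_topology) \<subseteq> sigma_sets Sub ?G"
  proof
    fix A :: "'k V set set" assume A: "A \<in> sets (borel_of Sub_topology)"
    then have "(\<lambda>W. W) -` A \<inter> space ?M = A"
      using sets.sets_into_space[OF A] G by auto
    then show "A \<in> sigma_sets Sub ?G" using measurable_sets[OF id A] G by simp
  qed
  show "sigma_sets Sub ?G \<subseteq> sets (borel_of Sub_topology)"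
    using sets.sigma_sets_subset[of ?G "borel_of Sub_topology"] sets_contains_subset by auto
qed

text \<open>Containment events of finite sets form a generating family stable under intersection, as
  two such conditions combine into the one for the union. Since \<open>W\<close> is a subspace, a
  finite set may be replaced by a maximal independent subset.\<close>

lemma measure_Sub_eqI:
  fixes M N :: "'k::{finite,field} V set measure"
  assumes "prob_space M" "prob_space N"
    and M: "sets M = sets (borel_of Sub_topology)" and N: "sets N = sets (borel_of Sub_topology)"
    and eq: "\<And>B. finite B \<Longrightarrow> V.independent B \<Longrightarrow> measure M {W\<in>Sub. B \<subseteq> W} = measure N {W\<in>Sub. B \<subseteq> W}"
  shows "M = N"
proof -
  interpret M: prob_space M by fact
  interpret N: prob_space N by fact
  let ?G = "(\<lambda>F. {W\<in>Sub. F \<subseteq> W}) ` {F :: 'k V set. finite F}"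
  show ?thesis
  proof (rule measure_eqI_generator_eq[where E = ?G and \<Omega> = Sub and A = "\<lambda>_. Sub"])
    show "Int_stable ?G"
    proof (rule Int_stableI, clarify)
      fix F F' :: "'k V set" assume "finite F" "finite F'"
      moreover have "{W\<in>Sub. F \<subseteq> W} \<inter> {W\<in>Sub. F' \<subseteq> W} = {W\<in>Sub. F \<union> F' \<subseteq> W}" by auto
      ultimately show "{W\<in>Sub. F \<subseteq> W} \<inter> {W\<in>Sub. F' \<subseteq> W} \<in> ?G" by blast
    qed
    fix X assume "X \<in> ?G"
    then obtain F :: "'k V set" where F: "finite F" "X = {W\<in>Sub. F \<subseteq> W}" by blast
    obtain B where B: "B \<subseteq> F" "V.independent B" "F \<subseteq> V.span B"
      using V.maximal_independent_subset[of F] by blast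
    have "X = {W\<in>Sub. B \<subseteq> W}"
    proof -
      have "F \<subseteq> W" if "V.subspace W" "B \<subseteq> W" for W
        using V.span_minimal[OF that(2,1)] B(3) by auto
      then show ?thesis using B(1) by (auto simp: F(2) Sub_def)
    qed
    then show "emeasure M X = emeasure N X"
      using eq[of B] B F(1) finite_subset[of B F]
      by (simp add: M.emeasure_eq_measure N.emeasure_eq_measure)
  next
    have "Sub = {W\<in>Sub. {} \<subseteq> W}" by auto
    then show "range (\<lambda>_. Sub) \<subseteq> ?G" by blast
  qed (use M N borel_of_Sub_generator in auto)
qed

subsection \<open>Haar measure on the homomorphisms\<close>

lemma Hom_add:
  assumes "g \<in> Hom \<kappa>" "h \<in> Hom \<kappa>"
  shows "(\<lambda>v. g v + h v) \<in> Hom \<kappa>"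
proof -
  have "Vector_Spaces.linear scale scale g" "Vector_Spaces.linear scale scale h"
    using assms by (auto simp: Hom_def)
  then have "Vector_Spaces.linear scale scale (\<lambda>v. g v + h v)"
    by (rule VV.linear_compose_add)
  then show ?thesis
    using assms by (fastforce simp: Hom_def intro: V.subspace_add[OF subspace_coord_space])
qed

lemma measurable_translation_Hom:
  fixes g :: "'k::{finite,field} V \<Rightarrow> 'k V"
  assumes g: "g \<in> Hom \<kappa>"
  shows "(\<lambda>h v. g v + h v) \<in> measurable (borel_of (Hom_topology \<kappa>)) (borel_of (Hom_topology \<kappa>))"
proof (rule measurable_borel_of_Hom)
  fix v x :: "'k V"
  have "{h \<in> Hom \<kappa>. g v + h v = x} = {h \<in> Hom \<kappa>. h v = x - g v}"
    by (auto simp: algebra_simps)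
  then show "{h \<in> space (borel_of (Hom_topology \<kappa>)). g v + h v = x} \<in> sets (borel_of (Hom_topology \<kappa>))"
    using sets_eval_Hom by simp
qed (use Hom_add g in auto)

text \<open>The values on \<open>B\<close> partition \<open>Hom \<kappa>\<close> into fibres, one
  for each function from \<open>B\<close> to \<open>coord_space \<kappa>\<close>. Translations
  permute the fibres, so they have equal measure, and \<open>B \<subseteq> Ker h\<close> is the
  fibre of the zero function.\<close>

lemma is_haar_Hom_measure_contains:
  fixes \<mu> :: "('k::{finite,field} V \<Rightarrow> 'k V) measure"
  assumes haar: "is_haar_Hom \<kappa> \<mu>" and B: "finite B" "V.independent B"
  shows "measure (distr \<mu> (borel_of Sub_topology) Ker) {W\<in>Sub. B \<subseteq> W} = (1 / real CARD('k) ^ \<kappa>) ^ card B"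
proof -
  interpret prob_space \<mu> using haar by (simp add: is_haar_Hom_def is_normalized_haar_def)
  have sets: "sets \<mu> = sets (borel_of (Hom_topology \<kappa>))"
    and inv: "\<And>g. g \<in> Hom \<kappa> \<Longrightarrow> distr \<mu> (borel_of (Hom_topology \<kappa>)) (\<lambda>h v. g v + h v) = \<mu>"
    using haar by (auto simp: is_haar_Hom_def is_normalized_haar_def)
  have space: "space \<mu> = Hom \<kappa>" using sets_eq_imp_space_eq[OF sets] by simp
  define A where "A c = {h\<in>Hom \<kappa>. \<forall>b\<in>B. h b = c b}" for c :: "'k V \<Rightarrow> 'k V"
  define C where "C = PiE B (\<lambda>_. coord_space \<kappa> :: 'k V set)"
  have A: "A c \<in> sets \<mu>" for c
    unfolding A_def space[symmetric]
    by (intro sets.sets_Collect_finite_All B) (simp add: space sets sets_eval_Hom)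
  have eq: "measure \<mu> (A c) = measure \<mu> (A (\<lambda>_. 0))" if c: "c \<in> C" for c
  proof -
    \<comment> \<open>Independence lets \<open>c\<close> extend to a linear map. The control of its
      range keeps it in \<open>Hom \<kappa>\<close>, so translation by it carries the zero fibre to
      the fibre of \<open>c\<close>.\<close>
    obtain g where g: "Vector_Spaces.linear scale scale g" "\<forall>b\<in>B. g b = c b" "range g = V.span (c ` B)"
      using VV.linear_independent_extend_subspace[OF B(2)] by blast
    have "c ` B \<subseteq> coord_space \<kappa>" using c by (auto simp: C_def)
    then have gH: "g \<in> Hom \<kappa>"
      using g V.span_minimal[OF _ subspace_coord_space] by (simp add: Hom_def)
    have tr: "(\<lambda>h v. g v + h v) \<in> measurable \<mu> (borel_of (Hom_topology \<kappa>))"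
      using measurable_translation_Hom[OF gH] measurable_cong_sets[OF sets refl] by blast
    have "measure \<mu> (A c) = measure (distr \<mu> (borel_of (Hom_topology \<kappa>)) (\<lambda>h v. g v + h v)) (A c)"
      using inv[OF gH] by simp
    also have "\<dots> = measure \<mu> ((\<lambda>h v. g v + h v) -` A c \<inter> space \<mu>)"
      using A[of c] by (intro measure_distr[OF tr]) (simp add: sets)
    also have "(\<lambda>h v. g v + h v) -` A c \<inter> space \<mu> = A (\<lambda>_. 0)"
      using g(2) Hom_add[OF gH] by (auto simp: A_def space)
    finally show ?thesis .
  qed
  have fin: "finite C" unfolding C_def by (intro finite_PiE B card_coord_space)
  have "1 = measure \<mu> (\<Union>c\<in>C. A c)"
  proof -
    have "h \<in> (\<Union>c\<in>C. A c)" if "h \<in> Hom \<kappa>" for h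
      using that by (intro UN_I[of "restrict h B"]) (auto simp: C_def A_def Hom_def)
    then have "(\<Union>c\<in>C. A c) = space \<mu>" by (auto simp: space A_def)
    then show ?thesis using prob_space by simp
  qed
  also have "\<dots> = (\<Sum>c\<in>C. measure \<mu> (A c))"
  proof (intro finite_measure_finite_Union fin)
    show "disjoint_family_on A C"
    proof (unfold disjoint_family_on_def, intro ballI impI)
      fix c d assume "c \<in> C" "d \<in> C" "c \<noteq> d"
      then obtain b where "b \<in> B" "c b \<noteq> d b" unfolding C_def by (metis PiE_ext)
      then show "A c \<inter> A d = {}" by (auto simp: A_def)
    qed
  qed (use A in auto)
  also have "\<dots> = real (card C) * measure \<mu> (A (\<lambda>_. 0))"
    by (simp add: eq)
  also have "real (card C) = (real CARD('k) ^ \<kappa>) ^ card B"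
    by (simp add: C_def card_PiE B card_coord_space)
  finally have "measure \<mu> (A (\<lambda>_. 0)) = (1 / real CARD('k) ^ \<kappa>) ^ card B"
    by (simp add: field_simps power_divide)
  moreover have "Ker -` {W\<in>Sub. B \<subseteq> W} \<inter> space \<mu> = A (\<lambda>_. 0)"
    using subspace_Ker by (auto simp: A_def space Sub_def Ker_def Hom_def)
  moreover have "Ker \<in> measurable \<mu> (borel_of Sub_topology)"
    using measurable_Ker measurable_cong_sets[OF sets refl] by blast
  ultimately show ?thesis
    by (simp add: measure_distr sets_contains_subset)
qed

section \<open>Construction of a Haar measure from independent uniform images of the basis
  vectors\<close>

definition coord_hom :: "(nat \<Rightarrow> 'k::field V) \<Rightarrow> 'k V \<Rightarrow> 'k V" where
  "coord_hom \<omega> v = (\<Sum>i\<in>Poly_Mapping.keys v. scale (Poly_Mapping.lookup v i) (\<omega> i))"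

text \<open>Summing over a fixed range instead of the support makes the sums for different vectors
  comparable, which the proof of linearity needs.\<close>

lemma coord_hom_eq:
  "v \<in> coord_space n \<Longrightarrow> coord_hom \<omega> v = (\<Sum>i<n. scale (Poly_Mapping.lookup v i) (\<omega> i))"
  unfolding coord_hom_def coord_space_def by (intro sum.mono_neutral_left) (auto simp: in_keys_iff)

lemma linear_coord_hom: "Vector_Spaces.linear scale scale (coord_hom \<omega>)"
proof -
  have "coord_hom \<omega> (v + w) = coord_hom \<omega> v + coord_hom \<omega> w" for v w
  proof -
    obtain n where n: "{v, w} \<subseteq> coord_space n" using finite_subset_coord_space[of "{v, w}"] by auto
    then have "v + w \<in> coord_space n" using V.subspace_add[OF subspace_coord_space] by auto
    with n show ?thesis
      by (simp add: coord_hom_eq[of _ n] lookup_add V.scale_left_distrib sum.distrib)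
  qed
  moreover have "coord_hom \<omega> (scale c v) = scale c (coord_hom \<omega> v)" for c v
  proof -
    obtain n where n: "v \<in> coord_space n" using ex_coord_space by blast
    then have "scale c v \<in> coord_space n" using V.subspace_scale[OF subspace_coord_space] by auto
    with n show ?thesis
      by (simp add: coord_hom_eq[of _ n] V.scale_sum_right)
  qed
  ultimately show ?thesis
    unfolding Vector_Spaces.linear_iff using V.vector_space_axioms by blast
qed

lemma linear_eq_coord_hom:
  assumes "Vector_Spaces.linear scale scale g"
  shows "g v = coord_hom (\<lambda>i. g (Poly_Mapping.single i 1)) v"
proof -
  interpret g: Vector_Spaces.linear scale scale g by fact
  have "v = (\<Sum>i\<in>Poly_Mapping.keys v. scale (Poly_Mapping.lookup v i) (Poly_Mapping.single i 1))"
    by (rule poly_mapping_eqI)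
      (simp add: lookup_sum lookup_single when_def in_keys_iff if_distrib[of "\<lambda>x. _ * x"] cong: if_cong)
  then have "g v = g (\<Sum>i\<in>Poly_Mapping.keys v. scale (Poly_Mapping.lookup v i) (Poly_Mapping.single i 1))"
    by simp
  then show ?thesis by (simp add: coord_hom_def g.sum g.scale)
qed

text \<open>Choose the images of the basis vectors independently and uniformly in
  \<open>coord_space \<kappa>\<close> and extend linearly. Translation by \<open>g\<close> then
  shifts each image by a constant, and this preserves the product of the uniform measures.\<close>

lemma ex_haar_Hom: "\<exists>\<mu> :: ('k::{finite,field} V \<Rightarrow> 'k V) measure. is_haar_Hom \<kappa> \<mu>"
proof -
  let ?C = "coord_space \<kappa> :: 'k V set"
  let ?u = "uniform_count_measure ?C"
  let ?P = "PiM (UNIV :: nat set) (\<lambda>_. ?u)"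
  have finC: "finite ?C" by (rule card_coord_space)
  have ps: "prob_space ?u"
    using finC by (rule prob_space_uniform_count_measure) (metis empty_iff zero_in_coord_space)
  interpret product_prob_space "\<lambda>_. ?u" "UNIV :: nat set"
    using ps by (rule product_prob_spaceI)
  have spaceP: "space ?P = (UNIV \<rightarrow>\<^sub>E ?C)"
    by (simp add: space_PiM space_uniform_count_measure)
  have Hom: "coord_hom \<omega> \<in> Hom \<kappa>" if "\<omega> \<in> space ?P" for \<omega>
  proof -
    have "coord_hom \<omega> v \<in> ?C" for v
      unfolding coord_hom_def using that
      by (intro V.subspace_sum[OF subspace_coord_space] V.subspace_scale[OF subspace_coord_space])
         (auto simp: spaceP PiE_iff)
    then show ?thesis by (auto simp: Hom_def linear_coord_hom)
  qed
  have comp: "{\<omega> \<in> space ?P. \<omega> i = x} \<in> sets ?P" for i x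
  proof (cases "x \<in> ?C")
    case True
    then have "{\<omega> \<in> space ?P. \<omega> i \<in> {x}} \<in> sets ?P"
      by (intro sets_Collect_single) (auto simp: sets_uniform_count_measure)
    then show ?thesis by simp
  next
    case False
    then have "{\<omega> \<in> space ?P. \<omega> i = x} = {}" by (auto simp: spaceP PiE_iff)
    then show ?thesis by (metis sets.empty_sets)
  qed
  have meas: "coord_hom \<in> measurable ?P (borel_of (Hom_topology \<kappa>))"
  proof (rule measurable_borel_of_Hom[OF Hom])
    fix v x :: "'k V"
    obtain n where n: "v \<in> coord_space n" using ex_coord_space by blast
    \<comment> \<open>The value at \<open>v\<close> depends only on the first \<open>n\<close>
      images, so the event is a finite union of cylinders.\<close>
    let ?F = "{c \<in> PiE {..<n} (\<lambda>_. ?C). (\<Sum>i<n. scale (Poly_Mapping.lookup v i) (c i)) = x}"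
    have "{\<omega> \<in> space ?P. coord_hom \<omega> v = x} = (\<Union>c\<in>?F. {\<omega> \<in> space ?P. \<forall>i\<in>{..<n}. \<omega> i = c i})"
    proof safe
      fix \<omega> assume "\<omega> \<in> space ?P" "x = coord_hom \<omega> v"
      then show "\<omega> \<in> (\<Union>c\<in>{c \<in> PiE {..<n} (\<lambda>_. ?C). (\<Sum>i<n. scale (Poly_Mapping.lookup v i) (c i)) = coord_hom \<omega> v}. {\<omega> \<in> space ?P. \<forall>i\<in>{..<n}. \<omega> i = c i})"
        by (intro UN_I[of "restrict \<omega> {..<n}"]) (auto simp: coord_hom_eq[OF n] spaceP PiE_iff)
    qed (simp add: coord_hom_eq[OF n])
    also have "\<dots> \<in> sets ?P"
      by (intro sets.finite_UN sets.sets_Collect_finite_All comp)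
        (auto intro!: finite_PiE finC)
    finally show "{\<omega> \<in> space ?P. coord_hom \<omega> v = x} \<in> sets ?P" .
  qed
  let ?\<mu> = "distr ?P (borel_of (Hom_topology \<kappa>)) coord_hom"
  have "distr ?\<mu> (borel_of (Hom_topology \<kappa>)) (\<lambda>h v. g v + h v) = ?\<mu>" if g: "g \<in> Hom \<kappa>" for g
  proof -
    define a where "a i = g (Poly_Mapping.single i 1)" for i
    have a: "a i \<in> ?C" for i using g by (auto simp: a_def Hom_def)
    \<comment> \<open>The shift of the sequence of images that corresponds to adding
      \<open>g\<close> to the homomorphism.\<close>
    define \<tau> where "\<tau> \<omega> i = a i + \<omega> i" for \<omega> :: "nat \<Rightarrow> 'k V" and i
    have add: "a i + x \<in> ?C \<longleftrightarrow> x \<in> ?C" for i x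
      using V.subspace_add[OF subspace_coord_space a[of i], of x]
        V.subspace_diff[OF subspace_coord_space _ a[of i], of "a i + x"] by auto
    have \<tau>meas: "\<tau> \<in> measurable ?P ?P"
      unfolding \<tau>_def[abs_def]
    proof (rule measurable_PiM_single')
      fix i :: nat
      have "(\<lambda>x. a i + x) \<in> measurable ?u ?u"
        using add by (auto simp: measurable_def space_uniform_count_measure sets_uniform_count_measure)
      then show "(\<lambda>\<omega>. a i + \<omega> i) \<in> measurable ?P ?u"
        using measurable_compose[OF measurable_component_singleton[of i UNIV "\<lambda>_. ?u"]] by simp
    qed (auto simp: spaceP space_uniform_count_measure PiE_iff add)
    \<comment> \<open>It is enough to compare finite cylinders. There each factor is moved by a
      translation of the finite group \<open>coord_space \<kappa>\<close>, which preserves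
      cardinality.\<close>
    have "distr ?P ?P \<tau> = ?P"
    proof (rule PiM_eq)
      fix J :: "nat set" and F :: "nat \<Rightarrow> 'k V set"
      assume J: "finite J" and F: "\<And>j. j \<in> J \<Longrightarrow> F j \<in> sets ?u"
      have "\<tau> -` prod_emb UNIV (\<lambda>_. ?u) J (Pi\<^sub>E J F) \<inter> space ?P =
          prod_emb UNIV (\<lambda>_. ?u) J (Pi\<^sub>E J (\<lambda>j. {x. a j + x \<in> F j} \<inter> ?C))"
        by (auto simp: prod_emb_def spaceP space_uniform_count_measure PiE_iff \<tau>_def add)
      then have "emeasure (distr ?P ?P \<tau>) (prod_emb UNIV (\<lambda>_. ?u) J (Pi\<^sub>E J F)) =
         emeasure ?P (prod_emb UNIV (\<lambda>_. ?u) J (Pi\<^sub>E J (\<lambda>j. {x. a j + x \<in> F j} \<inter> ?C)))"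
        using F J by (subst emeasure_distr[OF \<tau>meas]) (auto intro!: sets_PiM_I)
      also have "\<dots> = (\<Prod>j\<in>J. emeasure ?u ({x. a j + x \<in> F j} \<inter> ?C))"
        using J by (intro emeasure_PiM_emb) (auto simp: sets_uniform_count_measure)
      also have "\<dots> = (\<Prod>j\<in>J. emeasure ?u (F j))"
      proof (rule prod.cong[OF refl])
        fix j assume "j \<in> J"
        then have Fj: "F j \<subseteq> ?C" using F by (auto simp: sets_uniform_count_measure)
        have "(\<lambda>x. a j + x) ` ({x. a j + x \<in> F j} \<inter> ?C) = F j"
        proof safe
          fix y assume y: "y \<in> F j"
          then show "y \<in> (\<lambda>x. a j + x) ` ({x. a j + x \<in> F j} \<inter> ?C)"
            using Fj add[of j "y - a j"] by (intro image_eqI[of _ _ "y - a j"]) auto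
        qed
        then have "card ({x. a j + x \<in> F j} \<inter> ?C) = card (F j)"
          by (metis (no_types, lifting) card_image inj_onI add_left_cancel)
        then show "emeasure ?u ({x. a j + x \<in> F j} \<inter> ?C) = emeasure ?u (F j)"
          using finC Fj by (simp add: emeasure_uniform_count_measure)
      qed
      finally show "emeasure (distr ?P ?P \<tau>) (prod_emb UNIV (\<lambda>_. ?u) J (Pi\<^sub>E J F)) = (\<Prod>j\<in>J. emeasure ?u (F j))" .
    qed simp
    then have "?\<mu> = distr (distr ?P ?P \<tau>) (borel_of (Hom_topology \<kappa>)) coord_hom" by simp
    also have "\<dots> = distr ?P (borel_of (Hom_topology \<kappa>)) (coord_hom \<circ> \<tau>)"
      by (rule distr_distr[OF meas \<tau>meas])
    also have "coord_hom \<circ> \<tau> = (\<lambda>h v. g v + h v) \<circ> coord_hom"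
    proof (intro ext)
      fix \<omega> v
      have "Vector_Spaces.linear scale scale g" using g by (simp add: Hom_def)
      from linear_eq_coord_hom[OF this, of v]
      show "(coord_hom \<circ> \<tau>) \<omega> v = ((\<lambda>h v. g v + h v) \<circ> coord_hom) \<omega> v"
        by (simp add: coord_hom_def \<tau>_def a_def V.scale_right_distrib sum.distrib)
    qed
    also have "distr ?P (borel_of (Hom_topology \<kappa>)) \<dots> = distr ?\<mu> (borel_of (Hom_topology \<kappa>)) (\<lambda>h v. g v + h v)"
      by (rule distr_distr[OF measurable_translation_Hom[OF g] meas, symmetric])
    finally show ?thesis by (rule sym)
  qed
  then have "is_haar_Hom \<kappa> ?\<mu>"
    unfolding is_haar_Hom_def is_normalized_haar_def
    using P.prob_space_distr[OF meas] by simp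
  then show ?thesis ..
qed

subsection \<open>Invariant events\<close>

lemma Aut_image_Sub:
  assumes "f \<in> Aut" "W \<in> Sub"
  shows "f ` W \<in> Sub"
proof -
  have "Vector_Spaces.linear scale scale f" using assms(1) by (simp add: Aut_def)
  then show ?thesis using assms(2) VV.linear_subspace_image by (auto simp: Sub_def)
qed

lemma measurable_Aut_image:
  fixes f :: "'k::{finite,field} V \<Rightarrow> 'k V"
  assumes f: "f \<in> Aut"
  shows "(\<lambda>W. f ` W) \<in> measurable (borel_of Sub_topology) (borel_of Sub_topology)"
proof (rule measurable_borel_of_Sub)
  fix v :: "'k V"
  have "bij f" using f by (simp add: Aut_def)
  then have "v \<in> f ` W \<longleftrightarrow> inv f v \<in> W" for W
    using bij_image_Collect_eq[of f "\<lambda>x. x \<in> W"] by auto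
  then show "{W \<in> space (borel_of Sub_topology). v \<in> f ` W} \<in> sets (borel_of Sub_topology)"
    using sets_contains by simp
qed (use Aut_image_Sub[OF f] in auto)

lemma CRS_Aut_invariant:
  fixes lam :: "'k::{finite,field} V set measure"
  assumes lam: "lam \<in> CRS" and f: "f \<in> Aut" and A: "A \<in> sets (borel_of Sub_topology)"
  shows "measure lam {W\<in>Sub. f ` W \<in> A} = measure lam A"
proof -
  have sets: "sets lam = sets (borel_of Sub_topology)"
    and inv: "distr lam (borel_of Sub_topology) (\<lambda>W. f ` W) = lam"
    using lam f by (auto simp: CRS_def)
  have "space lam = Sub" using sets_eq_imp_space_eq[OF sets] by simp
  then have "(\<lambda>W. f ` W) -` A \<inter> space lam = {W\<in>Sub. f ` W \<in> A}" by auto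
  moreover have "(\<lambda>W. f ` W) \<in> measurable lam (borel_of Sub_topology)"
    using measurable_Aut_image[OF f] measurable_cong_sets[OF sets refl] by blast
  ultimately have "measure (distr lam (borel_of Sub_topology) (\<lambda>W. f ` W)) A = measure lam {W\<in>Sub. f ` W \<in> A}"
    using measure_distr[of "\<lambda>W. f ` W" lam "borel_of Sub_topology" A] A by simp
  then show ?thesis by (simp add: inv)
qed

text \<open>Conditioning on an invariant event keeps invariance: intersecting \<open>A\<close> with
  the preimage of \<open>E\<close> gives the preimage of \<open>A \<inter> E\<close>, whose measure
  is that of \<open>A \<inter> E\<close>.\<close>

lemma uniform_measure_CRS:
  fixes lam :: "'k::{finite,field} V set measure"
  assumes lam: "lam \<in> CRS" and A: "A \<in> sets (borel_of Sub_topology)" "measure lam A \<noteq> 0"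
    and inv: "\<And>f W. f \<in> Aut \<Longrightarrow> W \<in> Sub \<Longrightarrow> f ` W \<in> A \<longleftrightarrow> W \<in> A"
  shows "uniform_measure lam A \<in> CRS"
proof -
  interpret prob_space lam using lam by (simp add: CRS_def)
  have sets: "sets lam = sets (borel_of Sub_topology)" using lam by (simp add: CRS_def)
  have space: "space lam = Sub" using sets_eq_imp_space_eq[OF sets] by simp
  let ?U = "uniform_measure lam A"
  have em: "emeasure lam A \<noteq> 0" "emeasure lam A \<noteq> \<infinity>"
    using A(2) by (auto simp: emeasure_eq_measure)
  interpret U: prob_space ?U by (rule prob_space_uniform_measure[OF em])
  have "distr ?U (borel_of Sub_topology) (\<lambda>W. f ` W) = ?U" if f: "f \<in> Aut" for f
  proof (rule measure_eqI)
    have meas: "(\<lambda>W. f ` W) \<in> measurable ?U (borel_of Sub_topology)"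
    proof -
      have "sets ?U = sets (borel_of Sub_topology)" by (simp add: sets)
      from measurable_cong_sets[OF this refl] measurable_Aut_image[OF f] show ?thesis by blast
    qed
    fix E assume "E \<in> sets (distr ?U (borel_of Sub_topology) (\<lambda>W. f ` W))"
    then have E: "E \<in> sets (borel_of Sub_topology)" by simp
    have vE: "(\<lambda>W. f ` W) -` E \<inter> space ?U \<in> sets ?U" by (rule measurable_sets[OF meas E])
    have "emeasure (distr ?U (borel_of Sub_topology) (\<lambda>W. f ` W)) E = emeasure ?U ((\<lambda>W. f ` W) -` E \<inter> space ?U)"
      by (rule emeasure_distr[OF meas E])
    also have "\<dots> = emeasure lam (A \<inter> ((\<lambda>W. f ` W) -` E \<inter> space ?U)) / emeasure lam A"
      using A vE by (intro emeasure_uniform_measure) (auto simp: sets)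
    also have "A \<inter> ((\<lambda>W. f ` W) -` E \<inter> space ?U) = {W\<in>Sub. f ` W \<in> A \<inter> E}"
      using inv[OF f] by (auto simp: space)
    also have "emeasure lam {W\<in>Sub. f ` W \<in> A \<inter> E} = emeasure lam (A \<inter> E)"
      using CRS_Aut_invariant[OF lam f, of "A \<inter> E"] A(1) E by (simp add: emeasure_eq_measure)
    also have "emeasure lam (A \<inter> E) / emeasure lam A = emeasure ?U E"
      using A E by (intro emeasure_uniform_measure[symmetric]) (auto simp: sets)
    finally show "emeasure (distr ?U (borel_of Sub_topology) (\<lambda>W. f ` W)) E = emeasure ?U E" .
  qed (simp add: sets)
  then show ?thesis
    using U.prob_space_axioms by (simp add: CRS_def sets)
qed

text \<open>Otherwise the measure is a proper convex combination of its conditionings on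
  \<open>A\<close> and on the complement. Both are invariant, and they differ at
  \<open>A\<close>.\<close>

lemma CRS_extreme_zero_one:
  fixes lam :: "'k::{finite,field} V set measure"
  assumes lam: "lam \<in> CRS_extreme" and A: "A \<in> sets (borel_of Sub_topology)"
    and inv: "\<And>f W. f \<in> Aut \<Longrightarrow> W \<in> Sub \<Longrightarrow> f ` W \<in> A \<longleftrightarrow> W \<in> A"
  shows "measure lam A = 0 \<or> measure lam A = 1"
proof (rule ccontr)
  assume "\<not> (measure lam A = 0 \<or> measure lam A = 1)"
  then have nz: "measure lam A \<noteq> 0" "measure lam A \<noteq> 1" by auto
  have crs: "lam \<in> CRS" using lam by (simp add: CRS_extreme_def)
  interpret prob_space lam using crs by (simp add: CRS_def)
  have sets: "sets lam = sets (borel_of Sub_topology)" using crs by (simp add: CRS_def)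
  have space: "space lam = Sub" using sets_eq_imp_space_eq[OF sets] by simp
  let ?A' = "Sub - A"
  have A': "?A' \<in> sets (borel_of Sub_topology)"
    using sets.compl_sets[OF A] by simp
  have mA': "measure lam ?A' = 1 - measure lam A"
    using prob_compl[of A] A by (simp add: space sets)
  \<comment> \<open>The mass of the complement, since \<open>CRS_extreme\<close> gives the first
    measure the weight \<open>1 - t\<close>.\<close>
  define t where "t = measure lam ?A'"
  have t: "0 < t" "t < 1"
    using nz prob_le_1[of A] measure_nonneg[of lam A] by (simp_all add: t_def mA' less_le)
  let ?\<mu>1 = "uniform_measure lam A" and ?\<mu>2 = "uniform_measure lam ?A'"
  have "?\<mu>1 \<in> CRS" by (rule uniform_measure_CRS[OF crs A nz(1) inv])
  moreover have "?\<mu>2 \<in> CRS"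
    by (rule uniform_measure_CRS[OF crs A']) (use t inv Aut_image_Sub in \<open>auto simp: t_def\<close>)
  moreover have um: "measure (uniform_measure lam D) E = measure lam (D \<inter> E) / measure lam D"
    if "measure lam D \<noteq> 0" "E \<in> sets lam" for D E
    using that by (intro measure_uniform_measure) (auto simp: emeasure_eq_measure)
  have "measure ?\<mu>1 A = 1" "measure ?\<mu>2 A = 0"
    using nz A t by (auto simp: um sets t_def Int_commute[of "Sub - A"])
  then have "?\<mu>1 \<noteq> ?\<mu>2" by auto
  moreover have "measure lam E = (1 - t) * measure ?\<mu>1 E + t * measure ?\<mu>2 E"
    if E: "E \<in> sets (borel_of Sub_topology)" for E
  proof -
    have "E = (A \<inter> E) \<union> (?A' \<inter> E)"
      using sets.sets_into_space[OF E] by auto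
    then have "measure lam E = measure lam (A \<inter> E) + measure lam (?A' \<inter> E)"
      using A A' E finite_measure_Union[of "A \<inter> E" "?A' \<inter> E"] by (auto simp: sets)
    moreover have "1 - t = measure lam A" by (simp add: t_def mA')
    ultimately show ?thesis
      using nz t E by (simp add: um sets t_def)
  qed
  ultimately show False
    using lam t unfolding CRS_extreme_def by blast
qed

section \<open>The index of a subspace as an invariant\<close>

text \<open>This says that the index of \<open>W\<close> in \<open>V\<close> is at least
  \<open>m\<close>, through \<open>m\<close> pairwise incongruent vectors modulo \<open>W\<close>.
  Infinite index is membership for every \<open>m\<close>, and finite witnesses make the event
  visibly Borel.\<close>

definition index_ge :: "nat \<Rightarrow> 'k::field V set set" where
  "index_ge m = {W\<in>Sub. \<exists>S. finite S \<and> card S = m \<and> (\<forall>x\<in>S. \<forall>y\<in>S. x - y \<in> W \<longrightarrow> x = y)}"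

lemma index_ge_0 [simp]: "index_ge 0 = Sub"
  by (auto simp: index_ge_def intro: exI[of _ "{}"])

text \<open>There are only countably many candidate witnesses \<open>S\<close>, and each one imposes
  finitely many conditions on \<open>W\<close>.\<close>

lemma sets_index_ge: "index_ge m \<in> sets (borel_of (Sub_topology :: 'k::{finite,field} V set topology))"
proof -
  let ?S = "{S :: 'k V set. finite S \<and> card S = m}"
  let ?M = "borel_of (Sub_topology :: 'k V set topology)"
  have "countable ?S"
    using countable_Collect_finite_subset[OF countable_UNIV_V]
    by (rule countable_subset[rotated]) auto
  moreover have "{W\<in>space ?M. \<forall>x\<in>S. \<forall>y\<in>S. x - y \<in> W \<longrightarrow> x = y} \<in> sets ?M" if "S \<in> ?S" for S
    using that sets_contains
    by (intro sets.sets_Collect_finite_All sets.sets_Collect_imp sets.sets_Collect_const) auto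
  ultimately have "(\<Union>S\<in>?S. {W\<in>space ?M. \<forall>x\<in>S. \<forall>y\<in>S. x - y \<in> W \<longrightarrow> x = y}) \<in> sets ?M"
    by (intro sets.countable_UN'') auto
  also have "(\<Union>S\<in>?S. {W\<in>space ?M. \<forall>x\<in>S. \<forall>y\<in>S. x - y \<in> W \<longrightarrow> x = y}) = index_ge m"
    by (auto simp: index_ge_def)
  finally show ?thesis .
qed

lemma index_ge_Aut_invariant:
  assumes f: "f \<in> Aut" and W: "W \<in> Sub"
  shows "f ` W \<in> index_ge m \<longleftrightarrow> W \<in> index_ge m"
proof -
  have "Vector_Spaces.linear scale scale f" using f by (simp add: Aut_def)
  then interpret f: Vector_Spaces.linear scale scale f .
  have bij: "bij f" using f by (simp add: Aut_def)
  then have inj: "inj f" by (rule bij_is_inj)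
  have mem: "f x - f y \<in> f ` W \<longleftrightarrow> x - y \<in> W" for x y
    unfolding f.diff[symmetric] by (rule inj_image_mem_iff[OF inj])
  show ?thesis
  proof
    assume "f ` W \<in> index_ge m"
    then obtain S where S: "finite S" "card S = m" "\<forall>x\<in>S. \<forall>y\<in>S. x - y \<in> f ` W \<longrightarrow> x = y"
      by (auto simp: index_ge_def)
    have "S = f ` (f -` S)" using bij by (simp add: bij_is_surj)
    with S have "\<forall>x\<in>f -` S. \<forall>y\<in>f -` S. x - y \<in> W \<longrightarrow> x = y"
      by (metis mem inj injD vimageE)
    moreover have "finite (f -` S)" "card (f -` S) = m"
      using S inj bij by (auto simp: finite_vimageI card_vimage_inj bij_is_surj)
    ultimately show "W \<in> index_ge m" using W by (auto simp: index_ge_def)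
  next
    assume "W \<in> index_ge m"
    then obtain S where S: "finite S" "card S = m" "\<forall>x\<in>S. \<forall>y\<in>S. x - y \<in> W \<longrightarrow> x = y"
      by (auto simp: index_ge_def)
    then have "\<forall>x\<in>f ` S. \<forall>y\<in>f ` S. x - y \<in> f ` W \<longrightarrow> x = y"
      using mem by auto
    moreover have "finite (f ` S)" "card (f ` S) = m"
      using S inj by (auto simp: card_image inj_on_subset)
    ultimately show "f ` W \<in> index_ge m"
      using Aut_image_Sub[OF f W] by (auto simp: index_ge_def)
  qed
qed

subsection \<open>Density\<close>

text \<open>The translates of \<open>W \<inter> coord_space n\<close> by the witnesses are disjoint.
  They lie in \<open>coord_space n\<close> only once it contains the witnesses, hence the
  restriction to large \<open>n\<close>.\<close>

lemma index_ge_card: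
  fixes W :: "'k::{finite,field} V set"
  assumes "W \<in> index_ge m"
  shows "\<forall>\<^sub>F n in sequentially. m * card (W \<inter> coord_space n) \<le> card (coord_space n :: 'k V set)"
proof -
  obtain S where S: "finite S" "card S = m" "\<forall>x\<in>S. \<forall>y\<in>S. x - y \<in> W \<longrightarrow> x = y" and W: "V.subspace W"
    using assms by (auto simp: index_ge_def Sub_def)
  obtain N where N: "S \<subseteq> coord_space N" using finite_subset_coord_space[OF S(1)] by blast
  show ?thesis
  proof (rule eventually_sequentiallyI[of N])
    fix n assume "N \<le> n"
    then have Sn: "S \<subseteq> coord_space n" using N coord_space_mono by blast
    have "inj_on (\<lambda>(s, w). s + w) (S \<times> (W \<inter> coord_space n))"
    proof (rule inj_onI, clarify)
      fix s w s' w' assume *: "s \<in> S" "s' \<in> S" "w \<in> W" "w' \<in> W" "s + w = s' + w'"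
      then have "s - s' = w' - w" by (simp add: algebra_simps)
      then have "s - s' \<in> W" using V.subspace_diff[OF W] * by metis
      then have "s = s'" using S(3) * by blast
      then show "s = s' \<and> w = w'" using * by simp
    qed
    moreover have "(\<lambda>(s, w). s + w) ` (S \<times> (W \<inter> coord_space n)) \<subseteq> coord_space n"
      using Sn V.subspace_add[OF subspace_coord_space] by auto
    ultimately have "card (S \<times> (W \<inter> coord_space n)) \<le> card (coord_space n :: 'k V set)"
      by (rule card_inj_on_le) (rule card_coord_space)
    then show "m * card (W \<inter> coord_space n) \<le> card (coord_space n :: 'k V set)"
      using S by (simp add: card_cartesian_product)
  qed
qed

text \<open>A largest set of pairwise incongruent vectors in \<open>coord_space n\<close> has at
  most \<open>m\<close> elements, and by maximality its translates of
  \<open>W \<inter> coord_space n\<close> cover \<open>coord_space n\<close>. This works for every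
  \<open>n\<close>.\<close>

lemma not_index_ge_card:
  fixes W :: "'k::{finite,field} V set"
  assumes W: "W \<in> Sub" and not: "W \<notin> index_ge (Suc m)"
  shows "card (coord_space n :: 'k V set) \<le> m * card (W \<inter> coord_space n)"
proof -
  have sub: "V.subspace W" using W by (simp add: Sub_def)
  let ?P = "\<lambda>S. S \<subseteq> coord_space n \<and> (\<forall>x\<in>S. \<forall>y\<in>S. x - y \<in> W \<longrightarrow> x = y)"
  have fin: "finite S" if "?P S" for S
    using that card_coord_space(1) finite_subset by blast
  have "card S \<le> card (coord_space n :: 'k V set)" if "?P S" for S
    using that by (intro card_mono card_coord_space) auto
  \<comment> \<open>The principle of a greatest element used below asks for a strict bound, hence
    the \<open>Suc\<close>.\<close>
  then have "\<forall>S. ?P S \<longrightarrow> card S < Suc (card (coord_space n :: 'k V set))"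
    by (simp add: less_Suc_eq_le)
  then obtain S where S: "?P S" and max: "\<And>S'. ?P S' \<Longrightarrow> card S' \<le> card S"
    using ex_has_greatest_nat[of ?P "{}" card "Suc (card (coord_space n :: 'k V set))"] by auto
  have "card S \<le> m"
  proof (rule ccontr)
    assume "\<not> card S \<le> m"
    then obtain T where T: "T \<subseteq> S" "card T = Suc m"
      by (metis obtain_subset_with_card_n not_less_eq_eq)
    then have "W \<in> index_ge (Suc m)"
      unfolding index_ge_def using S W fin[OF S] finite_subset[of T S]
      by (intro CollectI conjI exI[of _ T]) auto
    with not show False by blast
  qed
  have "coord_space n \<subseteq> (\<lambda>(s, w). s + w) ` (S \<times> (W \<inter> coord_space n))"
  proof
    fix v :: "'k V" assume v: "v \<in> coord_space n"
    have "\<exists>s\<in>S. v - s \<in> W"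
    proof (rule ccontr)
      assume neg: "\<not> (\<exists>s\<in>S. v - s \<in> W)"
      moreover have "s - v \<notin> W" if "s \<in> S" for s
        using V.subspace_neg[OF sub, of "s - v"] neg that by auto
      ultimately have "?P (insert v S)" using S v by auto
      moreover have "v \<notin> S" using neg V.subspace_0[OF sub] by force
      ultimately show False using max[of "insert v S"] fin[OF S] by simp
    qed
    then obtain s where s: "s \<in> S" "v - s \<in> W" by blast
    then have "v - s \<in> coord_space n"
      using S v V.subspace_diff[OF subspace_coord_space] by auto
    with s show "v \<in> (\<lambda>(s, w). s + w) ` (S \<times> (W \<inter> coord_space n))"
      by (intro image_eqI[of _ _ "(s, v - s)"]) auto
  qed
  moreover have finp: "finite (S \<times> (W \<inter> coord_space n))"
    by (intro finite_cartesian_product fin[OF S] finite_Int disjI2 card_coord_space)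
  ultimately have "card (coord_space n :: 'k V set) \<le> card ((\<lambda>(s, w). s + w) ` (S \<times> (W \<inter> coord_space n)))"
    by (intro card_mono finite_imageI)
  also have "\<dots> \<le> card (S \<times> (W \<inter> coord_space n))"
    by (rule card_image_le[OF finp])
  also have "\<dots> \<le> m * card (W \<inter> coord_space n)"
    using \<open>card S \<le> m\<close> by (simp add: card_cartesian_product)
  finally show ?thesis .
qed

definition coord_density :: "'k::{finite,field} V set \<Rightarrow> nat \<Rightarrow> real" where
  "coord_density W n = real (card (W \<inter> coord_space n)) / real (card (coord_space n :: 'k V set))"

lemma card_field_ge_2: "2 \<le> CARD('k::{finite,field})"
proof -
  have "card {0, 1 :: 'k} \<le> CARD('k)" by (intro card_mono) auto
  then show ?thesis by simp
qed

lemma card_coord_space_pos: "0 < card (coord_space n :: 'k::{finite,field} V set)"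
  using card_field_ge_2[where 'k='k] by (simp add: card_coord_space(2))

lemma coord_density_le_1: "coord_density W n \<le> 1"
  unfolding coord_density_def using card_coord_space_pos[of n]
  by (simp add: divide_le_eq card_mono card_coord_space(1))

lemma index_ge_coord_density:
  fixes W :: "'k::{finite,field} V set"
  assumes "W \<in> index_ge m" "0 < m"
  shows "\<forall>\<^sub>F n in sequentially. coord_density W n \<le> 1 / m"
  using index_ge_card[OF assms(1)]
proof eventually_elim
  case (elim n)
  then have "real m * card (W \<inter> coord_space n) \<le> card (coord_space n :: 'k V set)"
    by (metis of_nat_le_iff of_nat_mult)
  then show ?case
    unfolding coord_density_def using card_coord_space_pos[of n, where 'k='k] assms(2)
    by (simp add: field_simps)
qed

text \<open>The covering bound gives \<open>1 / m\<close> from below for all \<open>n\<close>, the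
  packing bound gives it from above eventually. Here \<open>m\<close> is positive because zero
  translates cannot cover anything.\<close>

lemma index_coord_density_tendsto:
  fixes W :: "'k::{finite,field} V set"
  assumes "W \<in> index_ge m" "W \<notin> index_ge (Suc m)"
  shows "coord_density W \<longlonglongrightarrow> 1 / m"
proof -
  have W: "W \<in> Sub" using assms(1) by (simp add: index_ge_def)
  have m: "0 < m" using not_index_ge_card[OF W assms(2), of 0] card_coord_space_pos[of 0, where 'k='k]
    by (cases m) auto
  have "1 / m \<le> coord_density W n" for n
  proof -
    have "real (card (coord_space n :: 'k V set)) \<le> m * card (W \<inter> coord_space n)"
      using not_index_ge_card[OF W assms(2), of n] by (metis of_nat_le_iff of_nat_mult)
    then show ?thesis
      unfolding coord_density_def using card_coord_space_pos[of n, where 'k='k] m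
      by (simp add: field_simps)
  qed
  then show ?thesis
    using index_ge_coord_density[OF assms(1) m]
    by (intro tendsto_sandwich[of "\<lambda>_. 1 / m" "coord_density W" sequentially "\<lambda>_. 1 / m"]) auto
qed

lemma infinite_index_coord_density_tendsto:
  fixes W :: "'k::{finite,field} V set"
  assumes "\<And>m. W \<in> index_ge m"
  shows "coord_density W \<longlonglongrightarrow> 0"
proof (rule order_tendstoI)
  fix e :: real assume "0 < e"
  then obtain m where m: "1 / real (Suc m) < e"
    using nat_approx_posE by blast
  from index_ge_coord_density[OF assms, of "Suc m"]
  show "\<forall>\<^sub>F n in sequentially. coord_density W n < e"
    using m by (auto elim!: eventually_mono)
next
  fix e :: real assume "e < 0"
  moreover have "0 \<le> coord_density W n" for n by (simp add: coord_density_def)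
  ultimately show "\<forall>\<^sub>F n in sequentially. e < coord_density W n"
    by (intro always_eventually) (meson less_le_trans)
qed

text \<open>For one large \<open>n\<close> the packing and covering bounds coincide, so
  \<open>m\<close> times the power \<open>q ^ d\<close> counting
  \<open>W \<inter> coord_space n\<close> is \<open>q ^ n\<close>. Cancelling leaves
  \<open>m = q ^ (n - d)\<close>.\<close>

lemma finite_index_power:
  fixes W :: "'k::{finite,field} V set"
  assumes "W \<in> index_ge m" "W \<notin> index_ge (Suc m)"
  shows "\<exists>\<kappa>. m = CARD('k) ^ \<kappa>"
proof -
  have W: "W \<in> Sub" using assms(1) by (simp add: index_ge_def)
  obtain n where "m * card (W \<inter> coord_space n) \<le> card (coord_space n :: 'k V set)"
    using index_ge_card[OF assms(1)] by (auto simp: eventually_sequentially)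
  then have eq: "m * card (W \<inter> coord_space n) = CARD('k) ^ n"
    using not_index_ge_card[OF W assms(2), of n] by (simp add: card_coord_space(2))
  have "V.subspace (W \<inter> coord_space n)"
    using W V.subspace_inter subspace_coord_space by (auto simp: Sub_def)
  then obtain d where d: "card (W \<inter> coord_space n) = CARD('k) ^ d"
    using card_finite_subspace card_coord_space(1) by blast
  have q: "1 < CARD('k)" using card_field_ge_2[where 'k='k] by simp
  have "m \<noteq> 0" using eq q by (cases m) auto
  then have "CARD('k) ^ d \<le> CARD('k) ^ n" using eq d by (cases m) auto
  then have "d \<le> n" using q by (simp add: power_increasing_iff)
  then have "m * CARD('k) ^ d = CARD('k) ^ (n - d) * CARD('k) ^ d"
    using eq d by (simp flip: power_add)
  then show ?thesis using q by auto
qed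

subsection \<open>The law of an extreme random subspace\<close>

text \<open>An automorphism that fixes \<open>B\<close> and sends \<open>v\<close> to
  \<open>u\<close> transports one event to the other.\<close>

lemma CRS_contains_insert:
  fixes lam :: "'k::{finite,field} V set measure"
  assumes lam: "lam \<in> CRS" and B: "V.independent B" and v: "v \<notin> V.span B" "u \<notin> V.span B"
  shows "measure lam {W\<in>Sub. insert u B \<subseteq> W} = measure lam {W\<in>Sub. insert v B \<subseteq> W}"
proof -
  obtain f where f: "f \<in> Aut" "f v = u" "\<forall>b\<in>B. f b = b"
    using ex_Aut_fixing[OF B v] by blast
  have inj: "inj f" using f(1) by (simp add: Aut_def bij_is_inj)
  have "x \<in> f ` W \<longleftrightarrow> x \<in> W" if "x \<in> B" for x W
    using inj_image_mem_iff[OF inj, of x W] f(3) that by auto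
  moreover have "u \<in> f ` W \<longleftrightarrow> v \<in> W" for W
    using inj_image_mem_iff[OF inj, of v W] f(2) by auto
  ultimately have "{W\<in>Sub. f ` W \<in> {W\<in>Sub. insert u B \<subseteq> W}} = {W\<in>Sub. insert v B \<subseteq> W}"
    using Aut_image_Sub[OF f(1)] by (auto simp: subset_iff)
  then show ?thesis
    using CRS_Aut_invariant[OF lam f(1) sets_contains_subset[of "insert u B"]] by simp
qed

text \<open>The integral of the density over the event \<open>B \<subseteq> W\<close> is evaluated
  twice. It averages the probabilities of \<open>insert u B \<subseteq> W\<close> over
  \<open>u\<close>, nearly all of them equal; and by dominated convergence it tends to
  \<open>x\<close> times the probability of \<open>B \<subseteq> W\<close>. So each new element of
  \<open>B\<close> contributes one factor \<open>x\<close>.\<close>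

lemma CRS_measure_contains:
  fixes lam :: "'k::{finite,field} V set measure"
  assumes lam: "lam \<in> CRS" and dens: "AE W in lam. coord_density W \<longlonglongrightarrow> x"
    and B: "finite B" "V.independent B"
  shows "measure lam {W\<in>Sub. B \<subseteq> W} = x ^ card B"
  using B
proof (induction B)
  case empty
  interpret prob_space lam using lam by (simp add: CRS_def)
  have "space lam = Sub" using lam sets_eq_imp_space_eq[of lam "borel_of Sub_topology"] by (simp add: CRS_def)
  then show ?case using prob_space by simp
next
  case (insert v B)
  interpret prob_space lam using lam by (simp add: CRS_def)
  have sets: "sets lam = sets (borel_of Sub_topology)" using lam by (simp add: CRS_def)
  have space: "space lam = Sub" using sets_eq_imp_space_eq[OF sets] by simp
  have B: "V.independent B" and v: "v \<notin> V.span B"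
    using insert V.independent_insert[of v B] by auto
  define E where "E F = {W\<in>Sub. F \<subseteq> W}" for F :: "'k V set"
  have E [measurable]: "E F \<in> sets lam" for F
    unfolding E_def sets by (rule sets_contains_subset)
  define p where "p = measure lam (E (insert v B))"
  define c where "c n = real (card (coord_space n :: 'k V set))" for n
  define s where "s = real (card (V.span B))"
  have c_pos: "0 < c n" for n unfolding c_def using card_coord_space_pos by simp
  \<comment> \<open>The density counts the \<open>u\<close> in \<open>W\<close>, and for
    \<open>B \<subseteq> W\<close> these are the \<open>u\<close> with
    \<open>insert u B \<subseteq> W\<close>.\<close>
  have count: "indicator (E B) W * coord_density W n = (\<Sum>u\<in>coord_space n. indicator (E (insert u B)) W) / c n"
    if "W \<in> Sub" for W n
  proof -
    have "indicator (E (insert u B)) W = indicator (E B) W * (indicator W u :: real)" for u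
      using that by (auto simp: E_def indicator_def)
    then have "(\<Sum>u\<in>coord_space n. indicator (E (insert u B)) W) =
        indicator (E B) W * (\<Sum>u\<in>coord_space n. indicator W u :: real)"
      by (simp add: sum_distrib_left)
    also have "(\<Sum>u\<in>coord_space n. indicator W u :: real) = real (card (W \<inter> coord_space n))"
      using sum.inter_restrict[OF card_coord_space(1), of "\<lambda>_. 1 :: real" n W]
      by (simp add: indicator_def of_bool_def Int_commute)
    finally show ?thesis by (simp add: coord_density_def c_def)
  qed
  have integral: "(\<integral>W. indicator (E B) W * coord_density W n \<partial>lam) =
      (\<Sum>u\<in>coord_space n. measure lam (E (insert u B))) / c n" for n
  proof -
    have "(\<integral>W. indicator (E B) W * coord_density W n \<partial>lam) =
        (\<integral>W. (\<Sum>u\<in>coord_space n. indicator (E (insert u B)) W) / c n \<partial>lam)"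
      by (rule Bochner_Integration.integral_cong[OF refl]) (simp add: count space)
    also have "\<dots> = (\<Sum>u\<in>coord_space n. measure lam (E (insert u B))) / c n"
      by (simp add: E emeasure_eq_measure)
    finally show ?thesis .
  qed
  \<comment> \<open>Vectors \<open>u\<close> in the span of \<open>B\<close> add no condition and
    contribute the probability of \<open>E B\<close>; all others contribute \<open>p\<close>. There
    are \<open>s\<close> exceptions, a fixed number, so the correction vanishes as
    \<open>c n\<close> grows.\<close>
  have sum: "\<forall>\<^sub>F n in sequentially. (\<Sum>u\<in>coord_space n. measure lam (E (insert u B))) / c n =
      p + s * (measure lam (E B) - p) / c n"
  proof -
    obtain N where N: "B \<subseteq> coord_space N" using finite_subset_coord_space[OF insert.hyps(1)] by blast
    show ?thesis
    proof (rule eventually_sequentiallyI[of N])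
      fix n assume "N \<le> n"
      then have span: "V.span B \<subseteq> coord_space n"
        using N coord_space_mono[of N n] by (intro V.span_minimal subspace_coord_space) auto
      have "E (insert u B) = E B" if "u \<in> V.span B" for u
        using that V.span_minimal by (auto simp: E_def Sub_def)
      then have 1: "(\<Sum>u\<in>V.span B. measure lam (E (insert u B))) = s * measure lam (E B)"
        by (simp add: s_def)
      have "measure lam (E (insert u B)) = p" if "u \<notin> V.span B" for u
        unfolding E_def p_def by (rule CRS_contains_insert[OF lam B v that])
      then have 2: "(\<Sum>u\<in>coord_space n - V.span B. measure lam (E (insert u B))) = real (card (coord_space n - V.span B)) * p"
        by simp
      have "real (card (coord_space n - V.span B)) = c n - s"
        using span card_mono[OF card_coord_space(1) span]
        by (simp add: c_def s_def card_Diff_subset finite_subset[OF span] card_coord_space(1) of_nat_diff)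
      with 1 2 have "(\<Sum>u\<in>coord_space n. measure lam (E (insert u B))) = (c n - s) * p + s * measure lam (E B)"
        using sum.subset_diff[OF span card_coord_space(1), of "\<lambda>u. measure lam (E (insert u B))"] by simp
      then show "(\<Sum>u\<in>coord_space n. measure lam (E (insert u B))) / c n = p + s * (measure lam (E B) - p) / c n"
        using c_pos[of n] by (simp add: field_simps)
    qed
  qed
  have "filterlim c at_infinity sequentially"
  proof -
    have "filterlim (\<lambda>n. real CARD('k) ^ n) at_infinity sequentially"
      using card_field_ge_2[where 'k='k] by (intro filterlim_realpow_sequentially_gt1) auto
    then show ?thesis by (simp add: c_def[abs_def] card_coord_space(2))
  qed
  then have "(\<lambda>n. p + s * (measure lam (E B) - p) / c n) \<longlonglongrightarrow> p + 0"
    by (intro tendsto_intros tendsto_divide_0[OF tendsto_const])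
  then have lim1: "(\<lambda>n. \<integral>W. indicator (E B) W * coord_density W n \<partial>lam) \<longlonglongrightarrow> p"
    unfolding integral using tendsto_cong[OF sum] by simp
  have "(\<lambda>n. \<integral>W. indicator (E B) W * coord_density W n \<partial>lam) \<longlonglongrightarrow> (\<integral>W. indicator (E B) W * x \<partial>lam)"
  proof (rule integral_dominated_convergence[where w = "\<lambda>_. 1"])
    fix n
    \<comment> \<open>Measurability is read off the finite sum of indicators, which agrees with the
      integrand on \<open>Sub\<close> by \<open>count\<close>.\<close>
    have "(\<lambda>W. (\<Sum>u\<in>coord_space n. indicator (E (insert u B)) W) / c n) \<in> borel_measurable lam"
      by measurable
    then show "(\<lambda>W. indicator (E B) W * coord_density W n) \<in> borel_measurable lam"
      by (rule measurable_cong[THEN iffD2, rotated]) (simp add: count space)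
    show "AE W in lam. norm (indicator (E B) W * coord_density W n) \<le> 1"
      using coord_density_le_1 by (auto simp: indicator_def coord_density_def)
  next
    show "AE W in lam. (\<lambda>n. indicator (E B) W * coord_density W n) \<longlonglongrightarrow> indicator (E B) W * x"
      using dens by eventually_elim (intro tendsto_intros)
  qed auto
  moreover have "(\<integral>W. indicator (E B) W * x \<partial>lam) = measure lam (E B) * x"
    by (simp add: E emeasure_eq_measure)
  ultimately have "p = measure lam (E B) * x"
    using LIMSEQ_unique[OF lim1] by simp
  also have "measure lam (E B) = x ^ card B"
    unfolding E_def by (rule insert.IH[OF B])
  finally show ?case
    using insert.hyps by (simp add: p_def E_def mult.commute)
qed

text \<open>Each event \<open>index_ge m\<close> is invariant, so it has probability
  \<open>0\<close> or \<open>1\<close>. Either all have probability \<open>1\<close> and the index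
  is almost surely infinite, or the first one that fails fixes the index almost surely.\<close>

lemma CRS_extreme_coord_density:
  fixes lam :: "'k::{finite,field} V set measure"
  assumes lam: "lam \<in> CRS_extreme"
  shows "(AE W in lam. coord_density W \<longlonglongrightarrow> 0) \<or>
    (\<exists>\<kappa>. AE W in lam. coord_density W \<longlonglongrightarrow> 1 / real CARD('k) ^ \<kappa>)"
proof -
  have crs: "lam \<in> CRS" using lam by (simp add: CRS_extreme_def)
  interpret prob_space lam using crs by (simp add: CRS_def)
  have sets: "sets lam = sets (borel_of Sub_topology)" using crs by (simp add: CRS_def)
  have space: "space lam = Sub" using sets_eq_imp_space_eq[OF sets] by simp
  have I: "index_ge m \<in> sets lam" for m unfolding sets by (rule sets_index_ge)
  have zero_one: "measure lam (index_ge m) = 0 \<or> measure lam (index_ge m) = 1" for m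
    by (rule CRS_extreme_zero_one[OF lam sets_index_ge index_ge_Aut_invariant])
  show ?thesis
  proof (cases "\<forall>m. measure lam (index_ge m) = 1")
    case True
    then have "AE W in lam. \<forall>m. W \<in> index_ge m"
      unfolding AE_all_countable using I by (simp add: AE_in_set_eq_1)
    then have "AE W in lam. coord_density W \<longlonglongrightarrow> 0"
      by eventually_elim (auto intro: infinite_index_coord_density_tendsto)
    then show ?thesis ..
  next
    case False
    define m where "m = (LEAST m. measure lam (index_ge m) \<noteq> 1)"
    have m: "measure lam (index_ge m) \<noteq> 1"
      using False LeastI_ex[of "\<lambda>m. measure lam (index_ge m) \<noteq> 1"] by (auto simp: m_def)
    \<comment> \<open>The least failing \<open>m\<close> is not \<open>0\<close>, because
      \<open>index_ge 0\<close> is the whole space.\<close>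
    then obtain k where k: "m = Suc k" using prob_space by (cases m) (auto simp: space)
    have "measure lam (index_ge k) = 1"
      using not_less_Least[of k "\<lambda>m. measure lam (index_ge m) \<noteq> 1"] k by (simp add: m_def)
    then have "AE W in lam. W \<in> index_ge k" using I by (simp add: AE_in_set_eq_1)
    moreover have "AE W in lam. W \<notin> index_ge (Suc k)"
    proof -
      have "measure lam (index_ge (Suc k)) = 0" using m zero_one[of m] k by simp
      then show ?thesis using I by (intro AE_not_in null_setsI) (auto simp: emeasure_eq_measure)
    qed
    ultimately have AE: "AE W in lam. W \<in> index_ge k \<and> W \<notin> index_ge (Suc k)"
      by eventually_elim simp
    \<comment> \<open>One actual subspace of index \<open>k\<close> is needed to see that
      \<open>k\<close> is a power of \<open>q\<close>; an almost sure property of a probability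
      measure has an instance.\<close>
    have "\<exists>W :: 'k V set. W \<in> index_ge k \<and> W \<notin> index_ge (Suc k)"
    proof (rule ccontr)
      assume no: "\<not> ?thesis"
      have "AE W in lam. False" by (rule eventually_mono[OF AE]) (use no in blast)
      then show False by simp
    qed
    then obtain W :: "'k V set" where W: "W \<in> index_ge k" "W \<notin> index_ge (Suc k)" by blast
    obtain \<kappa> where "k = CARD('k) ^ \<kappa>" using finite_index_power[OF W] by blast
    then have k: "1 / real k = 1 / real CARD('k) ^ \<kappa>" by simp
    from AE have "AE W in lam. coord_density W \<longlonglongrightarrow> 1 / real k"
      by eventually_elim (use index_coord_density_tendsto in blast)
    then have "AE W in lam. coord_density W \<longlonglongrightarrow> 1 / real CARD('k) ^ \<kappa>"
      unfolding k .
    then show ?thesis by blast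
  qed
qed

theorem theorem1p6:
  fixes lam :: "('k::{finite,field}) V set measure"
  assumes "lam \<in> CRS_extreme"
    and "lam \<noteq> return (borel_of Sub_topology) {0}"
  shows "\<exists>!\<kappa>::nat. \<exists>\<mu>. is_haar_Hom \<kappa> \<mu> \<and> distr \<mu> (borel_of Sub_topology) Ker = lam"
proof -
  have crs: "lam \<in> CRS" using assms(1) by (simp add: CRS_extreme_def)
  interpret prob_space lam using crs by (simp add: CRS_def)
  have sets: "sets lam = sets (borel_of Sub_topology)" using crs by (simp add: CRS_def)
  \<comment> \<open>Limit \<open>0\<close> would give the containment probabilities
    \<open>0 ^ card B\<close>, that is \<open>1\<close> for empty \<open>B\<close> and
    \<open>0\<close> otherwise. These are the values of the Dirac measure at \<open>{0}\<close>,
    because an independent set does not contain \<open>0\<close>.\<close>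
  have "\<not> (AE W in lam. coord_density W \<longlonglongrightarrow> 0)"
  proof
    assume AE: "AE W in lam. coord_density W \<longlonglongrightarrow> 0"
    have zero: "{0 :: 'k V} \<in> Sub" by (simp add: Sub_def V.subspace_single_0)
    have "lam = return (borel_of Sub_topology) {0}"
    proof (rule measure_Sub_eqI)
      show "prob_space lam" by unfold_locales
      show "prob_space (return (borel_of Sub_topology) {0 :: 'k V})"
        using zero by (intro prob_space_return) simp
      fix B :: "'k V set" assume B: "finite B" "V.independent B"
      have "B \<subseteq> {0} \<longleftrightarrow> B = {}"
        using V.dependent_zero[of B] B(2) by auto
      then show "measure lam {W\<in>Sub. B \<subseteq> W} = measure (return (borel_of Sub_topology) {0}) {W\<in>Sub. B \<subseteq> W}"
        using CRS_measure_contains[OF crs AE B] zero B(1)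
        by (simp add: measure_return[OF sets_contains_subset] indicator_def zero_power_eq power_0_left)
    qed (simp_all add: sets)
    with assms(2) show False by blast
  qed
  then obtain \<kappa> where AE: "AE W in lam. coord_density W \<longlonglongrightarrow> 1 / real CARD('k) ^ \<kappa>"
    using CRS_extreme_coord_density[OF assms(1)] by blast
  show ?thesis
  proof (rule ex1I)
    obtain \<mu> :: "('k V \<Rightarrow> 'k V) measure" where \<mu>: "is_haar_Hom \<kappa> \<mu>"
      using ex_haar_Hom by blast
    \<comment> \<open>Both laws give \<open>B \<subseteq> W\<close> the probability
      \<open>(1 / q ^ \<kappa>) ^ card B\<close> for every finite independent
      \<open>B\<close>.\<close>
    have "distr \<mu> (borel_of Sub_topology) Ker = lam"
    proof (rule measure_Sub_eqI)
      show "prob_space (distr \<mu> (borel_of Sub_topology) Ker)"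
      proof (rule prob_space.prob_space_distr)
        show "prob_space \<mu>" using \<mu> by (simp add: is_haar_Hom_def is_normalized_haar_def)
        have "sets \<mu> = sets (borel_of (Hom_topology \<kappa>))"
          using \<mu> by (simp add: is_haar_Hom_def is_normalized_haar_def)
        from measurable_cong_sets[OF this refl] measurable_Ker
        show "Ker \<in> measurable \<mu> (borel_of Sub_topology)" by blast
      qed
      show "prob_space lam" by unfold_locales
      fix B :: "'k V set" assume "finite B" "V.independent B"
      then show "measure (distr \<mu> (borel_of Sub_topology) Ker) {W\<in>Sub. B \<subseteq> W} = measure lam {W\<in>Sub. B \<subseteq> W}"
        using is_haar_Hom_measure_contains[OF \<mu>] CRS_measure_contains[OF crs AE] by simp
    qed (simp_all add: sets)
    with \<mu> show "\<exists>\<mu>. is_haar_Hom \<kappa> \<mu> \<and> distr \<mu> (borel_of Sub_topology) Ker = lam" by blast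
  next
    fix \<kappa>' assume "\<exists>\<mu>. is_haar_Hom \<kappa>' \<mu> \<and> distr \<mu> (borel_of Sub_topology) Ker = lam"
    then obtain \<mu> where \<mu>: "is_haar_Hom \<kappa>' \<mu>" "distr \<mu> (borel_of Sub_topology) Ker = lam" by blast
    \<comment> \<open>A single nonzero vector suffices for uniqueness: it lies in the kernel with
      probability \<open>1 / q ^ \<kappa>'\<close>, which determines the exponent because
      \<open>q > 1\<close>.\<close>
    let ?B = "{Poly_Mapping.single 0 1 :: 'k V}"
    have B: "finite ?B" "V.independent ?B" by (auto simp: V.independent_insert)
    have "1 / real CARD('k) ^ \<kappa>' = 1 / real CARD('k) ^ \<kappa>"
      using is_haar_Hom_measure_contains[OF \<mu>(1) B] CRS_measure_contains[OF crs AE B] \<mu>(2) by simp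
    then have "real CARD('k) ^ \<kappa>' = real CARD('k) ^ \<kappa>"
      using card_field_ge_2[where 'k='k] by (simp add: divide_simps)
    then show "\<kappa>' = \<kappa>"
      using card_field_ge_2[where 'k='k] by (subst (asm) power_inject_exp) auto
  qed
qed

end
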